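(* Assume the Axiom of Determinacy in addition to ZF (ZF + AD). For every $a_0,b_0\in\mathbb{R}$ with $a_0<b_0$ and for every uncountable set $S\subset[a_0,b_0]$, player A has a winning strategy in the Cantor game on $[a_0,b_0]$ with target set $S$.
   Context: "Countable" includes finite; "uncountable" means not countable. The Axiom of Determinacy (AD): for every set $X\subset\mathbb{N}^{\mathbb{N}}$, in the infinite game in which two players alternately choose natural numbers $n_0,n_1,n_2,\dots$ and the first player wins iff $(n_0,n_1,n_2,\dots)\in X$, one of the two players has a winning strategy. The Axiom of Choice is not assumed. Cantor game on $[a_0,b_0]$ with target set $S\subset[a_0,b_0]$: $a_0<b_0$ are fixed reals. At turn $n\ge1$ player A chooses a real $a_n$ with $a_{n-1}<a_n<b_{n-1}$, then player B chooses a real $b_n$ with $a_n<b_n<b_{n-1}$. Player A wins if $\lim_{n\to\infty}a_n\in S$; otherwise player B wins. A play is a pair of sequences $((a_n)_{n\ge0},(b_n)_{n\ge0})$, starting with the fixed $a_0,b_0$, with $a_{n-1}<a_n<b_n<b_{n-1}$ for all $n\ge1$. A strategy for player A is a sequence of real-valued functions $(f_n)_{n\ge0}$, where for $n\ge1$ the function $f_{n-1}$ is defined on all tuples $(a_0,b_0,a_1,b_1,\dots,a_{n-1},b_{n-1})$ (with $a_0,b_0$ the fixed values) satisfying $a_0<a_1<\dots<a_{n-1}<b_{n-1}<\dots<b_1<b_0$, and $a_{n-1}<f_{n-1}(a_0,b_0,\dots,a_{n-1},b_{n-1})<b_{n-1}$. A play is consistent with $(f_n)$ if $a_n=f_{n-1}(a_0,b_0,\dots,a_{n-1},b_{n-1})$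 for all $n\ge1$. The limit set $L((f_n))$ is the set of all $\lim_{n\to\infty}a_n$ over plays consistent with $(f_n)$. The strategy $(f_n)$ is winning for player A if $L((f_n))\subset S$. *)

theory Defs
  imports Main
begin

text \<open>
  The logic HOL proves the axiom of choice and hence refutes determinacy for the
  HOL type \<^typ>\<open>nat \<Rightarrow> nat\<close>; determinacy as a hypothesis on that type would be
  contradictory.  "Theorem of ZF + AD" is therefore rendered as "true in every model of
  ZF + AD".  A model is a type \<open>'v\<close> with an arbitrary binary relation as membership; it need
  be neither well-founded nor standard.  Separation and replacement are the first-order
  schemas (with parameters), so no choice principle leaks from HOL into the model.

  All mathematical notions below (natural numbers, functions, reals, countability, games) are
  the internal ones of the model.  Their definitions quantify only over elements of the model.
\<close>

section \<open>Models of ZF\<close>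

datatype fm = Member nat nat | Equal nat nat | Neg fm | Conj fm fm | Forall nat fm

primrec sat :: "('v \<Rightarrow> 'v \<Rightarrow> bool) \<Rightarrow> fm \<Rightarrow> (nat \<Rightarrow> 'v) \<Rightarrow> bool" where
  "sat mem (Member i j) e \<longleftrightarrow> mem (e i) (e j)"
| "sat mem (Equal i j) e \<longleftrightarrow> e i = e j"
| "sat mem (Neg p) e \<longleftrightarrow> \<not> sat mem p e"
| "sat mem (Conj p q) e \<longleftrightarrow> sat mem p e \<and> sat mem q e"
| "sat mem (Forall i p) e \<longleftrightarrow> (\<forall>x. sat mem p (e(i := x)))"

context
  fixes mem :: "'v \<Rightarrow> 'v \<Rightarrow> bool"  (infix "\<epsilon>" 50)
begin

definition extensionality :: bool where
  "extensionality \<longleftrightarrow> (\<forall>x y. (\<forall>z. z \<epsilon> x \<longleftrightarrow> z \<epsilon> y) \<longrightarrow> x = y)"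

definition foundation :: bool where
  "foundation \<longleftrightarrow> (\<forall>x. (\<exists>y. y \<epsilon> x) \<longrightarrow> (\<exists>y. y \<epsilon> x \<and> \<not> (\<exists>z. z \<epsilon> x \<and> z \<epsilon> y)))"

definition pairing :: bool where
  "pairing \<longleftrightarrow> (\<forall>x y. \<exists>p. \<forall>z. z \<epsilon> p \<longleftrightarrow> z = x \<or> z = y)"

definition union :: bool where
  "union \<longleftrightarrow> (\<forall>x. \<exists>u. \<forall>z. z \<epsilon> u \<longleftrightarrow> (\<exists>y. y \<epsilon> x \<and> z \<epsilon> y))"

definition powerset :: bool where
  "powerset \<longleftrightarrow> (\<forall>x. \<exists>p. \<forall>z. z \<epsilon> p \<longleftrightarrow> (\<forall>y. y \<epsilon> z \<longrightarrow> y \<epsilon> x))"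

definition infinity :: bool where
  "infinity \<longleftrightarrow> (\<exists>I. (\<exists>z. z \<epsilon> I \<and> (\<forall>x. \<not> x \<epsilon> z)) \<and>
     (\<forall>x. x \<epsilon> I \<longrightarrow> (\<exists>y. y \<epsilon> I \<and> (\<forall>z. z \<epsilon> y \<longleftrightarrow> z \<epsilon> x \<or> z = x))))"

text \<open>In both schemas the variables other than 0 (and 1) serve as parameters.\<close>

definition separation :: bool where
  "separation \<longleftrightarrow> (\<forall>p e A. \<exists>B. \<forall>x. x \<epsilon> B \<longleftrightarrow> x \<epsilon> A \<and> sat mem p (e(0 := x)))"

definition replacement :: bool where
  "replacement \<longleftrightarrow> (\<forall>p e A.
     (\<forall>x y y'. x \<epsilon> A \<and> sat mem p (e(0 := x, 1 := y)) \<and> sat mem p (e(0 := x, 1 := y'))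
        \<longrightarrow> y = y') \<longrightarrow>
     (\<exists>B. \<forall>y. y \<epsilon> B \<longleftrightarrow> (\<exists>x. x \<epsilon> A \<and> sat mem p (e(0 := x, 1 := y)))))"

definition ZF_model :: bool where
  "ZF_model \<longleftrightarrow> extensionality \<and> foundation \<and> pairing \<and> union \<and> powerset \<and> infinity
     \<and> separation \<and> replacement"


section \<open>Basic set theory inside a model\<close>

text \<open>
  \<open>setof P\<close> is the set \<open>{x | P x}\<close>.  It is only applied to those \<open>P\<close> whose extension is a set,
  provably in ZF and for all values of the parameters.
\<close>

definition setof :: "('v \<Rightarrow> bool) \<Rightarrow> 'v" where
  "setof P = (THE s. \<forall>x. x \<epsilon> s \<longleftrightarrow> P x)"

definition subset_of :: "'v \<Rightarrow> 'v \<Rightarrow> bool" where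
  "subset_of A B \<longleftrightarrow> (\<forall>x. x \<epsilon> A \<longrightarrow> x \<epsilon> B)"

definition upair :: "'v \<Rightarrow> 'v \<Rightarrow> 'v" where
  "upair x y = setof (\<lambda>z. z = x \<or> z = y)"

definition pair :: "'v \<Rightarrow> 'v \<Rightarrow> 'v" where
  "pair x y = upair (upair x x) (upair x y)"

definition cart :: "'v \<Rightarrow> 'v \<Rightarrow> 'v" where
  "cart A B = setof (\<lambda>p. \<exists>x y. x \<epsilon> A \<and> y \<epsilon> B \<and> p = pair x y)"

definition emptyset :: 'v where
  "emptyset = setof (\<lambda>x. False)"

definition succ :: "'v \<Rightarrow> 'v" where
  "succ n = setof (\<lambda>x. x \<epsilon> n \<or> x = n)"

definition omega :: 'v where
  "omega = setof (\<lambda>n. \<forall>I. emptyset \<epsilon> I \<and> (\<forall>k. k \<epsilon> I \<longrightarrow> succ k \<epsilon> I) \<longrightarrow> n \<epsilon> I)"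

definition function_on :: "'v \<Rightarrow> 'v \<Rightarrow> bool" where
  "function_on f A \<longleftrightarrow> (\<forall>p. p \<epsilon> f \<longrightarrow> (\<exists>x y. x \<epsilon> A \<and> p = pair x y)) \<and>
     (\<forall>x. x \<epsilon> A \<longrightarrow> (\<exists>!y. pair x y \<epsilon> f))"

text \<open>
  Function application as the union of \<open>{y | (x, y) \<in> f}\<close>; this is the value \<open>f(x)\<close> whenever
  there is exactly one such \<open>y\<close>, and it is a set for all \<open>f\<close> and \<open>x\<close>.
\<close>

definition app :: "'v \<Rightarrow> 'v \<Rightarrow> 'v" where
  "app f x = setof (\<lambda>z. \<exists>y. pair x y \<epsilon> f \<and> z \<epsilon> y)"

definition maps :: "'v \<Rightarrow> 'v \<Rightarrow> 'v \<Rightarrow> bool" where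
  "maps f A B \<longleftrightarrow> function_on f A \<and> (\<forall>x. x \<epsilon> A \<longrightarrow> app f x \<epsilon> B)"

definition restr :: "'v \<Rightarrow> 'v \<Rightarrow> 'v" where
  "restr f A = setof (\<lambda>p. p \<epsilon> f \<and> (\<exists>x y. x \<epsilon> A \<and> p = pair x y))"

text \<open>Finite sets are countable in this sense.\<close>

definition countable_set :: "'v \<Rightarrow> bool" where
  "countable_set A \<longleftrightarrow> (\<exists>f. maps f A omega \<and>
     (\<forall>x y. x \<epsilon> A \<and> y \<epsilon> A \<and> app f x = app f y \<longrightarrow> x = y))"


section \<open>The axiom of determinacy\<close>

text \<open>A natural number \<open>n\<close> is the set of its predecessors, so a map on \<open>n\<close> is an \<open>n\<close>-tuple.\<close>

definition finseqs :: "'v \<Rightarrow> 'v" where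
  "finseqs A = setof (\<lambda>s. \<exists>n. n \<epsilon> omega \<and> maps s n A)"

definition even_nat :: "'v \<Rightarrow> bool" where
  "even_nat n \<longleftrightarrow> (\<exists>D. subset_of D omega \<and> emptyset \<epsilon> D \<and>
     (\<forall>k. k \<epsilon> omega \<longrightarrow> (succ k \<epsilon> D \<longleftrightarrow> \<not> k \<epsilon> D)) \<and> n \<epsilon> D)"

text \<open>
  The first player makes the moves with even index, the second player those with odd index.
  The move prescribed by a strategy \<open>s\<close> at index \<open>n\<close> is the value of \<open>s\<close> at the tuple
  \<open>restr z n\<close> of the earlier moves.
\<close>

definition wins_first :: "'v \<Rightarrow> 'v \<Rightarrow> bool" where
  "wins_first s X \<longleftrightarrow> (\<forall>z. maps z omega omega \<and>
     (\<forall>n. n \<epsilon> omega \<and> even_nat n \<longrightarrow> app z n = app s (restr z n)) \<longrightarrow> z \<epsilon> X)"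

definition wins_second :: "'v \<Rightarrow> 'v \<Rightarrow> bool" where
  "wins_second s X \<longleftrightarrow> (\<forall>z. maps z omega omega \<and>
     (\<forall>n. n \<epsilon> omega \<and> \<not> even_nat n \<longrightarrow> app z n = app s (restr z n)) \<longrightarrow> \<not> z \<epsilon> X)"

definition AD :: bool where
  "AD \<longleftrightarrow> (\<forall>X. (\<forall>x. x \<epsilon> X \<longrightarrow> maps x omega omega) \<longrightarrow>
     (\<exists>s. maps s (finseqs omega) omega \<and> wins_first s X) \<or>
     (\<exists>s. maps s (finseqs omega) omega \<and> wins_second s X))"


section \<open>The real numbers\<close>

text \<open>
  The reals are an arbitrary Dedekind complete ordered field of the model; ZF proves that there
  is one and that it is unique up to isomorphism.
\<close>

definition abelian_group :: "'v \<Rightarrow> ('v \<Rightarrow> 'v \<Rightarrow> 'v) \<Rightarrow> 'v \<Rightarrow> bool" where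
  "abelian_group G f u \<longleftrightarrow> u \<epsilon> G \<and>
     (\<forall>x y. x \<epsilon> G \<and> y \<epsilon> G \<longrightarrow> f x y \<epsilon> G) \<and>
     (\<forall>x y z. x \<epsilon> G \<and> y \<epsilon> G \<and> z \<epsilon> G \<longrightarrow> f (f x y) z = f x (f y z)) \<and>
     (\<forall>x y. x \<epsilon> G \<and> y \<epsilon> G \<longrightarrow> f x y = f y x) \<and>
     (\<forall>x. x \<epsilon> G \<longrightarrow> f x u = x) \<and>
     (\<forall>x. x \<epsilon> G \<longrightarrow> (\<exists>y. y \<epsilon> G \<and> f x y = u))"

definition less_in :: "'v \<Rightarrow> 'v \<Rightarrow> 'v \<Rightarrow> bool" where
  "less_in lt x y \<longleftrightarrow> pair x y \<epsilon> lt"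

definition leq_in :: "'v \<Rightarrow> 'v \<Rightarrow> 'v \<Rightarrow> bool" where
  "leq_in lt x y \<longleftrightarrow> less_in lt x y \<or> x = y"

definition op2 :: "'v \<Rightarrow> 'v \<Rightarrow> 'v \<Rightarrow> 'v" where
  "op2 f x y = app f (pair x y)"

definition upper_bound :: "'v \<Rightarrow> 'v \<Rightarrow> 'v \<Rightarrow> 'v \<Rightarrow> bool" where
  "upper_bound R lt A u \<longleftrightarrow> u \<epsilon> R \<and> (\<forall>x. x \<epsilon> A \<longrightarrow> leq_in lt x u)"

definition complete_ordered_field :: "'v \<Rightarrow> 'v \<Rightarrow> 'v \<Rightarrow> 'v \<Rightarrow> 'v \<Rightarrow> 'v \<Rightarrow> bool" where
  "complete_ordered_field R add mul lt zr one \<longleftrightarrow>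
     maps add (cart R R) R \<and> maps mul (cart R R) R \<and> subset_of lt (cart R R) \<and>
     abelian_group R (op2 add) zr \<and>
     abelian_group (setof (\<lambda>x. x \<epsilon> R \<and> x \<noteq> zr)) (op2 mul) one \<and>
     (\<forall>x y. x \<epsilon> R \<and> y \<epsilon> R \<longrightarrow> op2 mul x y = op2 mul y x) \<and>
     (\<forall>x y z. x \<epsilon> R \<and> y \<epsilon> R \<and> z \<epsilon> R \<longrightarrow>
        op2 mul x (op2 add y z) = op2 add (op2 mul x y) (op2 mul x z)) \<and>
     (\<forall>x. x \<epsilon> R \<longrightarrow> \<not> less_in lt x x) \<and>
     (\<forall>x y z. less_in lt x y \<and> less_in lt y z \<longrightarrow> less_in lt x z) \<and>
     (\<forall>x y. x \<epsilon> R \<and> y \<epsilon> R \<longrightarrow> less_in lt x y \<or> x = y \<or> less_in lt y x) \<and>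
     (\<forall>x y z. less_in lt x y \<and> z \<epsilon> R \<longrightarrow> less_in lt (op2 add x z) (op2 add y z)) \<and>
     (\<forall>x y. less_in lt zr x \<and> less_in lt zr y \<longrightarrow> less_in lt zr (op2 mul x y)) \<and>
     (\<forall>A. subset_of A R \<and> (\<exists>x. x \<epsilon> A) \<and> (\<exists>u. upper_bound R lt A u) \<longrightarrow>
        (\<exists>u. upper_bound R lt A u \<and> (\<forall>v. upper_bound R lt A v \<longrightarrow> leq_in lt u v)))"

definition closed_interval :: "'v \<Rightarrow> 'v \<Rightarrow> 'v \<Rightarrow> 'v \<Rightarrow> 'v" where
  "closed_interval R lt a b = setof (\<lambda>x. x \<epsilon> R \<and> leq_in lt a x \<and> leq_in lt x b)"

text \<open>
  The last line is \<open>\<bar>x\<^sub>n - l\<bar> < d\<close>; on natural numbers, \<open>\<epsilon>\<close> is the strict order.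
\<close>

definition seq_limit :: "'v \<Rightarrow> 'v \<Rightarrow> 'v \<Rightarrow> 'v \<Rightarrow> 'v \<Rightarrow> 'v \<Rightarrow> bool" where
  "seq_limit R add lt zr x l \<longleftrightarrow> l \<epsilon> R \<and> (\<forall>d. d \<epsilon> R \<and> less_in lt zr d \<longrightarrow>
     (\<exists>N. N \<epsilon> omega \<and> (\<forall>n. n \<epsilon> omega \<and> (N = n \<or> N \<epsilon> n) \<longrightarrow>
        less_in lt (app x n) (op2 add l d) \<and> less_in lt l (op2 add (app x n) d))))"


section \<open>The Cantor game\<close>

definition cantor_play :: "'v \<Rightarrow> 'v \<Rightarrow> 'v \<Rightarrow> 'v \<Rightarrow> 'v \<Rightarrow> 'v \<Rightarrow> bool" where
  "cantor_play R lt a0 b0 a b \<longleftrightarrow> maps a omega R \<and> maps b omega R \<and>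
     app a emptyset = a0 \<and> app b emptyset = b0 \<and>
     (\<forall>n. n \<epsilon> omega \<longrightarrow> less_in lt (app a n) (app a (succ n)) \<and>
        less_in lt (app a (succ n)) (app b (succ n)) \<and> less_in lt (app b (succ n)) (app b n))"

text \<open>
  \<open>positions R lt a0 b0 n\<close> is the set of tuples \<open>(a\<^sub>0, b\<^sub>0, \<dots>, a\<^bsub>n-1\<^esub>, b\<^bsub>n-1\<^esub>)\<close> with
  \<open>a\<^sub>0 < \<dots> < a\<^bsub>n-1\<^esub> < b\<^bsub>n-1\<^esub> < \<dots> < b\<^sub>0\<close> and the given \<open>a\<^sub>0, b\<^sub>0\<close>, for \<open>n \<ge> 1\<close>.  Such a tuple
  is encoded as the pair of the \<open>n\<close>-tuples \<open>(a\<^sub>0, \<dots>, a\<^bsub>n-1\<^esub>)\<close> and \<open>(b\<^sub>0, \<dots>, b\<^bsub>n-1\<^esub>)\<close>.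
\<close>

definition positions :: "'v \<Rightarrow> 'v \<Rightarrow> 'v \<Rightarrow> 'v \<Rightarrow> 'v \<Rightarrow> 'v" where
  "positions R lt a0 b0 n = setof (\<lambda>p. \<exists>a b. p = pair a b \<and> maps a n R \<and> maps b n R \<and>
     app a emptyset = a0 \<and> app b emptyset = b0 \<and>
     (\<forall>k. k \<epsilon> n \<longrightarrow> less_in lt (app a k) (app b k)) \<and>
     (\<forall>k. succ k \<epsilon> n \<longrightarrow> less_in lt (app a k) (app a (succ k)) \<and>
        less_in lt (app b (succ k)) (app b k)))"

text \<open>A strategy is a sequence \<open>F\<close> of functions, \<open>F(m)\<close> giving the move \<open>a\<^bsub>m+1\<^esub>\<close>.\<close>

definition strategy_A :: "'v \<Rightarrow> 'v \<Rightarrow> 'v \<Rightarrow> 'v \<Rightarrow> 'v \<Rightarrow> bool" where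
  "strategy_A R lt a0 b0 F \<longleftrightarrow> function_on F omega \<and>
     (\<forall>m. m \<epsilon> omega \<longrightarrow> maps (app F m) (positions R lt a0 b0 (succ m)) R \<and>
        (\<forall>a b. pair a b \<epsilon> positions R lt a0 b0 (succ m) \<longrightarrow>
           less_in lt (app a m) (app (app F m) (pair a b)) \<and>
           less_in lt (app (app F m) (pair a b)) (app b m)))"

definition consistent_play :: "'v \<Rightarrow> 'v \<Rightarrow> 'v \<Rightarrow> bool" where
  "consistent_play F a b \<longleftrightarrow> (\<forall>m. m \<epsilon> omega \<longrightarrow>
     app a (succ m) = app (app F m) (pair (restr a (succ m)) (restr b (succ m))))"

definition limit_set :: "'v \<Rightarrow> 'v \<Rightarrow> 'v \<Rightarrow> 'v \<Rightarrow> 'v \<Rightarrow> 'v \<Rightarrow> 'v \<Rightarrow> 'v" where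
  "limit_set R add lt zr a0 b0 F = setof (\<lambda>l. \<exists>a b. cantor_play R lt a0 b0 a b \<and>
     consistent_play F a b \<and> seq_limit R add lt zr a l)"

definition winning_strategy_A ::
    "'v \<Rightarrow> 'v \<Rightarrow> 'v \<Rightarrow> 'v \<Rightarrow> 'v \<Rightarrow> 'v \<Rightarrow> 'v \<Rightarrow> 'v \<Rightarrow> bool" where
  "winning_strategy_A R add lt zr a0 b0 S F \<longleftrightarrow>
     strategy_A R lt a0 b0 F \<and> subset_of (limit_set R add lt zr a0 b0 F) S"

end

end

theory Submission
  imports Defs
begin

text \<open>
  Determinacy is applied to a game on the cuts \<open>{n | q(n) < x}\<close> of the reals \<open>x \<in> S\<close>, where \<open>q\<close>
  enumerates a dense set.  At each stage the first player either prescribes the next bit of a cut or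
  leaves it to the second player; he has to do the latter infinitely often and to produce the cut of
  an element of \<open>S\<close>.

  If the second player wins, consider for \<open>x \<in> S\<close> the play in which the first player leaves a bit
  open exactly when the second player's reply to that will be the bit of \<open>x\<close>.  This happens
  only finitely often, and the position after the last time determines \<open>x\<close>; so \<open>S\<close> is countable.

  If the first player wins, call \<open>x\<close> a target if its cut arises when the second player
  answers by 0 from some stage on.  There are only countably many targets, which allows to choose
  between them without the axiom of choice, and above each target there are arbitrarily close ones:
  the second player changes a late answer to 1.  Player A of the Cantor game always moves to a target.
  As \<open>x \<mapsto> {n | q(n) < x}\<close> is left continuous, the limit of an increasing sequence of targets is
  the result of a play against the same winning strategy and hence belongs to \<open>S\<close>.
\<close>

section \<open>Definable predicates and terms\<close>

text \<open>The model may have nonstandard natural numbers, and the choice, induction and recursion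
  of HOL say nothing about its sets. Hence every internal set, induction and recursion rests on a
  definable predicate, and every function value has to be unique instead of chosen. Infinitely many
  open bits are demanded for two reasons. A winning second player who replies correctly can rely
  only on their being finite in number, so finite data determine \<open>x\<close>. For a winning
  first player they supply arbitrarily late places where a target can be altered. The altered play
  is won again, so it is the cut of another element of \<open>S\<close>; this is larger because a
  point of the dense set enters its cut, and close because the earlier bits are kept. Player A's
  moves increase, so only limits from the left occur. This is why cuts use the strict inequality:
  whether a given point lies in the cut of \<open>x\<close> does not change when \<open>x\<close> is
  replaced by a real slightly below it.\<close>

text \<open>
  \<open>dP P\<close> states that the predicate \<open>P\<close> of assignments is first-order definable with parameters;
  \<open>dT t\<close> states the same of the graph of \<open>t\<close>, the value being variable 0.  In \<open>interleave e c\<close> the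
  even variables are free and the odd ones are parameters.  The rules \<open>dfn\<close> reduce definability to
  the syntactic shape of a predicate, with variables in de Bruijn style.
\<close>

primrec rename :: "(nat \<Rightarrow> nat) \<Rightarrow> fm \<Rightarrow> fm" where
  "rename f (Member i j) = Member (f i) (f j)"
| "rename f (Equal i j) = Equal (f i) (f j)"
| "rename f (Neg p) = Neg (rename f p)"
| "rename f (Conj p q) = Conj (rename f p) (rename f q)"
| "rename f (Forall i p) = Forall (f i) (rename f p)"

text \<open>Injectivity keeps the variable bound by a quantifier apart from all others.\<close>

lemma sat_rename:
  assumes "inj f"
  shows "sat mem (rename f p) e \<longleftrightarrow> sat mem p (\<lambda>i. e (f i))"
proof (induction p arbitrary: e)
  case (Forall i p)
  have "(\<lambda>k. (e(f i := x)) (f k)) = (\<lambda>k. e (f k))(i := x)" for x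
    using assms by (auto simp: fun_eq_iff inj_eq)
  then show ?case using Forall by simp
qed simp_all

definition interleave :: "(nat \<Rightarrow> 'v) \<Rightarrow> (nat \<Rightarrow> 'v) \<Rightarrow> nat \<Rightarrow> 'v" where
  "interleave e c i = (if even i then e (i div 2) else c (i div 2))"

locale zf =
  fixes mem :: "'v \<Rightarrow> 'v \<Rightarrow> bool"  (infix "\<epsilon>" 50)
  assumes model: "ZF_model mem"
begin

definition dP :: "((nat \<Rightarrow> 'v) \<Rightarrow> bool) \<Rightarrow> bool" where
  "dP P \<longleftrightarrow> (\<exists>p c. \<forall>e. P e \<longleftrightarrow> sat mem p (interleave e c))"

definition dT :: "((nat \<Rightarrow> 'v) \<Rightarrow> 'v) \<Rightarrow> bool" where
  "dT t \<longleftrightarrow> dP (\<lambda>e. e 0 = t (\<lambda>i. e (Suc i)))"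

lemma dP_reindex:
  assumes "dP P" "inj g"
  shows "dP (\<lambda>e. P (\<lambda>i. e (g i)))"
proof -
  obtain p c where p: "\<And>e. P e \<longleftrightarrow> sat mem p (interleave e c)"
    using assms(1) unfolding dP_def by blast
  \<comment> \<open>Free variables occupy the even positions, so \<open>g\<close> acts on their
    halves while the parameters stay in place.\<close>
  define f where "f i = (if even i then 2 * g (i div 2) else i)" for i
  have "inj f"
  proof (rule injI)
    fix x y assume "f x = f y"
    then show "x = y" using assms(2)
      by (auto simp: f_def inj_eq elim!: evenE split: if_splits)
  qed
  have "interleave e c (f i) = interleave (\<lambda>i. e (g i)) c i" for e i
    by (simp add: interleave_def f_def)
  then show ?thesis unfolding dP_def
    using sat_rename[OF \<open>inj f\<close>, of mem p] p by (intro exI[of _ "rename f p"] exI[of _ c]) simp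
qed

lemma dP_Member: "dP (\<lambda>e. e i \<epsilon> e j)"
  unfolding dP_def by (intro exI[of _ "Member (2*i) (2*j)"]) (simp add: interleave_def)

lemma dP_Equal: "dP (\<lambda>e. e i = e j)"
  unfolding dP_def by (intro exI[of _ "Equal (2*i) (2*j)"]) (simp add: interleave_def)

lemma dP_param: "dP (\<lambda>e. e i = c)"
  unfolding dP_def by (intro exI[of _ "Equal (2*i) 1"] exI[of _ "\<lambda>_. c"]) (simp add: interleave_def)

lemma dP_not: "dP P \<Longrightarrow> dP (\<lambda>e. \<not> P e)"
  unfolding dP_def by (metis sat.simps(3))

lemma dP_conj:
  assumes "dP P" "dP Q"
  shows "dP (\<lambda>e. P e \<and> Q e)"
proof -
  obtain p c where p: "\<And>e. P e \<longleftrightarrow> sat mem p (interleave e c)"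
    using assms(1) unfolding dP_def by blast
  obtain q d where q: "\<And>e. Q e \<longleftrightarrow> sat mem q (interleave e d)"
    using assms(2) unfolding dP_def by blast
  \<comment> \<open>The parameters are merged into \<open>interleave c d\<close>: position 2k+1
    moves to 4k+1 in the first formula and to 4k+3 in the second.\<close>
  define f g where "f i = (if even i then i else 2 * i - 1)"
    and "g i = (if even i then i else 2 * i + 1)" for i :: nat
  have inj: "inj f" "inj g"
    by (rule injI; auto simp: f_def g_def elim!: evenE oddE split: if_splits; presburger)+
  have "interleave e (interleave c d) (f i) = interleave e c i \<and>
    interleave e (interleave c d) (g i) = interleave e d i" for e i
  proof (cases "even i")
    case False
    then obtain k where "i = 2 * k + 1" by (blast elim: oddE)
    moreover have "f (2 * k + 1) = 2 * (2 * k) + 1" "g (2 * k + 1) = 2 * (2 * k + 1) + 1"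
      by (simp_all add: f_def g_def)
    moreover have "interleave a b (2 * k) = a k" "interleave a b (2 * k + 1) = b k"
      for a b :: "nat \<Rightarrow> 'v" and k
      by (simp_all add: interleave_def)
    ultimately show ?thesis by metis
  qed (simp add: interleave_def f_def g_def)
  then show ?thesis unfolding dP_def
    using sat_rename[OF inj(1), of mem p] sat_rename[OF inj(2), of mem q] p q
    by (intro exI[of _ "Conj (rename f p) (rename g q)"] exI[of _ "interleave c d"]) simp
qed

lemma dP_all:
  assumes "dP (\<lambda>e. Q (e 0) (\<lambda>i. e (Suc i)))"
  shows "dP (\<lambda>e. \<forall>x. Q x e)"
proof -
  obtain p c where p: "\<And>e. Q (e 0) (\<lambda>i. e (Suc i)) \<longleftrightarrow> sat mem p (interleave e c)"
    using assms unfolding dP_def by blast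
  \<comment> \<open>Position 1 becomes the quantified variable: 0 moves there, the other even
    positions move down by 2 and the odd ones up by 2.\<close>
  define g where "g i = (if i = 0 then 1 else if even i then i - 2 else i + 2)" for i :: nat
  have inj: "inj g"
    by (rule injI; auto simp: g_def elim!: evenE oddE split: if_splits; presburger)
  define d where "d = case_nat (c 0) c"
  have "(\<lambda>i. ((interleave e d)(1 := x)) (g i)) = interleave (case_nat x e) c" for e x
  proof
    fix i show "((interleave e d)(1 := x)) (g i) = interleave (case_nat x e) c i"
    proof (cases "even i")
      case True
      then obtain k where "i = 2 * k" by blast
      then show ?thesis by (cases k) (auto simp: interleave_def g_def)
    next
      case False
      then show ?thesis by (auto simp: interleave_def g_def d_def elim!: oddE)
    qed
  qed
  then have "Q x e \<longleftrightarrow> sat mem (rename g p) ((interleave e d)(1 := x))" for x e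
    using p[of "case_nat x e"] sat_rename[OF inj, of mem p "(interleave e d)(1 := x)"] by simp
  then show ?thesis unfolding dP_def
    by (intro exI[of _ "Forall 1 (rename g p)"] exI[of _ d]) simp
qed

lemma dP_disj: "dP P \<Longrightarrow> dP Q \<Longrightarrow> dP (\<lambda>e. P e \<or> Q e)"
  using dP_not[OF dP_conj[OF dP_not dP_not]] by simp

lemma dP_imp: "dP P \<Longrightarrow> dP Q \<Longrightarrow> dP (\<lambda>e. P e \<longrightarrow> Q e)"
  using dP_not[OF dP_conj[OF _ dP_not]] by simp

lemma dP_iff: "dP P \<Longrightarrow> dP Q \<Longrightarrow> dP (\<lambda>e. P e \<longleftrightarrow> Q e)"
  using dP_conj[OF dP_imp dP_imp, of P Q Q P] by (simp add: iff_conv_conj_imp)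

lemma dP_ex: "dP (\<lambda>e. Q (e 0) (\<lambda>i. e (Suc i))) \<Longrightarrow> dP (\<lambda>e. \<exists>x. Q x e)"
  using dP_not[OF dP_all[of "\<lambda>x e. \<not> Q x e"]] dP_not by simp

lemma dT_shift: "dT t \<Longrightarrow> dT (\<lambda>e. t (\<lambda>i. e (Suc i)))"
  unfolding dT_def
  using dP_reindex[of "\<lambda>e. e 0 = t (\<lambda>i. e (Suc i))" "case_nat 0 (\<lambda>i. Suc (Suc i))"]
  by (simp add: inj_def split: nat.splits)

lemma dT_var: "dT (\<lambda>e. e i)"
  unfolding dT_def by (rule dP_Equal)

lemma dT_const: "dT (\<lambda>e. c)"
  unfolding dT_def by (rule dP_param)

text \<open>Formulas contain no terms; a term enters as an existentially quantified variable equal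
  to its value.\<close>

lemma dP_subst:
  assumes "dP (\<lambda>e. Q (e 0) (\<lambda>i. e (Suc i)))" "dT t"
  shows "dP (\<lambda>e. Q (t e) e)"
  using dP_ex[of "\<lambda>x e. x = t e \<and> Q x e"] dP_conj[OF assms(2)[unfolded dT_def] assms(1)] by simp

lemma dP_subst1:
  assumes "dP (\<lambda>e. Q (e 0))" "dT t"
  shows "dP (\<lambda>e. Q (t e))"
  using dP_subst[of "\<lambda>x e. Q x" t] assms by simp

lemma dP_subst2:
  assumes "dP (\<lambda>e. Q (e 0) (e (Suc 0)))" "dT t" "dT u"
  shows "dP (\<lambda>e. Q (t e) (u e))"
proof -
  have "dP (\<lambda>e. Q (t (\<lambda>i. e (Suc i))) (e 0))"
    by (rule dP_subst[of "\<lambda>x e. Q x (e 0)" "\<lambda>e. t (\<lambda>i. e (Suc i))"])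
      (use assms(1) dT_shift[OF assms(2)] in auto)
  then show ?thesis using dP_subst[of "\<lambda>x e. Q (t e) x" u] assms(3) by simp
qed

lemma dP_subst3:
  assumes "dP (\<lambda>e. Q (e 0) (e (Suc 0)) (e (Suc (Suc 0))))" "dT t" "dT u" "dT v"
  shows "dP (\<lambda>e. Q (t e) (u e) (v e))"
proof -
  have "dP (\<lambda>e. Q (t (\<lambda>i. e (Suc (Suc i)))) (e 0) (e (Suc 0)))"
    by (rule dP_subst[of "\<lambda>x e. Q x (e 0) (e (Suc 0))" "\<lambda>e. t (\<lambda>i. e (Suc (Suc i)))"])
      (use assms(1) dT_shift[OF dT_shift[OF assms(2)]] in auto)
  then have "dP (\<lambda>e. Q (t (\<lambda>i. e (Suc i))) (u (\<lambda>i. e (Suc i))) (e 0))"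
    using dP_subst[of "\<lambda>x e. Q (t (\<lambda>i. e (Suc i))) x (e 0)" "\<lambda>e. u (\<lambda>i. e (Suc i))"]
      dT_shift[OF assms(3)] by simp
  then show ?thesis using dP_subst[of "\<lambda>x e. Q (t e) (u e) x" v] assms(4) by simp
qed

lemma dP_mem: "dT t \<Longrightarrow> dT u \<Longrightarrow> dP (\<lambda>e. t e \<epsilon> u e)"
  by (rule dP_subst2[of "\<lambda>x y. x \<epsilon> y"]) (rule dP_Member)

lemma dP_eq: "dT t \<Longrightarrow> dT u \<Longrightarrow> dP (\<lambda>e. t e = u e)"
  by (rule dP_subst2[of "\<lambda>x y. x = y"]) (rule dP_Equal)

lemma dP_bool: "dP (\<lambda>e. b)"
  using dP_eq[OF dT_const dT_const, of undefined undefined] dP_not by (cases b) force+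

lemma dT_fun1:
  assumes "dP (\<lambda>e. e (Suc 0) = F (e 0))" "dT t"
  shows "dT (\<lambda>e. F (t e))"
  unfolding dT_def using dP_subst2[of "\<lambda>x y. y = F x", OF assms(1) dT_shift[OF assms(2)] dT_var[of 0]] .

lemma dT_fun2:
  assumes "dP (\<lambda>e. e (Suc (Suc 0)) = F (e 0) (e (Suc 0)))" "dT t" "dT u"
  shows "dT (\<lambda>e. F (t e) (u e))"
  unfolding dT_def using dP_subst3[of "\<lambda>x y z. z = F x y", OF assms(1) dT_shift[OF assms(2)]
      dT_shift[OF assms(3)] dT_var[of 0]] .

lemma dT_if:
  assumes "dP P" "dT t" "dT u"
  shows "dT (\<lambda>e. if P e then t e else u e)"
proof -
  have P: "dP (\<lambda>e. P (\<lambda>i. e (Suc i)))"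
    using dP_reindex[OF assms(1), of Suc] by simp
  have "dP (\<lambda>e. P (\<lambda>i. e (Suc i)) \<and> e 0 = t (\<lambda>i. e (Suc i)) \<or>
      \<not> P (\<lambda>i. e (Suc i)) \<and> e 0 = u (\<lambda>i. e (Suc i)))"
    by (intro dP_disj dP_conj dP_not P assms(2,3)[unfolded dT_def])
  also have "(\<lambda>e. P (\<lambda>i. e (Suc i)) \<and> e 0 = t (\<lambda>i. e (Suc i)) \<or>
      \<not> P (\<lambda>i. e (Suc i)) \<and> e 0 = u (\<lambda>i. e (Suc i))) =
     (\<lambda>e. e 0 = (if P (\<lambda>i. e (Suc i)) then t (\<lambda>i. e (Suc i)) else u (\<lambda>i. e (Suc i))))"
    by auto
  finally show ?thesis unfolding dT_def .
qed

lemmas dfn = dP_bool dP_not dP_conj dP_disj dP_imp dP_iff dP_all dP_ex dP_mem dP_eq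
  dT_var dT_const dT_if

section \<open>Separation and replacement for definable predicates\<close>

lemma ex_separation:
  assumes "dP (\<lambda>e. P (e 0))"
  shows "\<exists>B. \<forall>x. x \<epsilon> B \<longleftrightarrow> x \<epsilon> A \<and> P x"
proof -
  obtain p c where p: "\<And>e. P (e 0) \<longleftrightarrow> sat mem p (interleave e c)"
    using assms unfolding dP_def by blast
  have "(interleave e c)(0 := x) = interleave (e(0 := x)) c" for e x
    by (auto simp: interleave_def fun_eq_iff)
  then have "P x \<longleftrightarrow> sat mem p ((interleave e c)(0 := x))" for x e
    using p[of "e(0 := x)"] by simp
  then show ?thesis
    using model unfolding ZF_model_def separation_def by metis
qed

lemma ex_replacement:
  assumes "dP (\<lambda>e. Q (e 0) (e (Suc 0)))"
    and "\<And>x y y'. x \<epsilon> A \<Longrightarrow> Q x y \<Longrightarrow> Q x y' \<Longrightarrow> y = y'"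
  shows "\<exists>B. \<forall>y. y \<epsilon> B \<longleftrightarrow> (\<exists>x. x \<epsilon> A \<and> Q x y)"
proof -
  obtain p c where p: "\<And>e. Q (e 0) (e (Suc 0)) \<longleftrightarrow> sat mem p (interleave e c)"
    using assms unfolding dP_def by blast
  \<comment> \<open>The replacement schema takes its output in variable 1, whereas
    \<open>interleave\<close> puts the second free variable at 2; moving the parameters up by 2
    makes room.\<close>
  define g where "g i = (if even i then if i = 2 then 1 else i else i + 2)" for i :: nat
  have inj: "inj g"
    by (rule injI; auto simp: g_def elim!: evenE oddE split: if_splits; presburger)
  define E where "E = interleave c (case_nat (c 0) c)"
  have "(\<lambda>i. (E(0 := x, 1 := y)) (g i)) = interleave (c(0 := x, 1 := y)) c" for x y
    by (rule ext) (auto simp: E_def g_def interleave_def elim!: evenE oddE)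
  then have Q: "Q x y \<longleftrightarrow> sat mem (rename g p) (E(0 := x, 1 := y))" for x y
    using p[of "c(0 := x, 1 := y)"] sat_rename[OF inj, of mem p "E(0 := x, 1 := y)"] by simp
  have "replacement mem" using model by (simp add: ZF_model_def)
  from this[unfolded replacement_def, rule_format, of A "rename g p" E, folded Q]
  show ?thesis using assms(2) by blast
qed

abbreviation opair  ("\<langle>_,/ _\<rangle>") where "\<langle>x, y\<rangle> \<equiv> pair mem x y"
abbreviation fapp  (infixl "\<cdot>" 90) where "f \<cdot> x \<equiv> app mem f x"
abbreviation frestr  (infixl "\<restriction>" 95) where "f \<restriction> A \<equiv> restr mem f A"
abbreviation nats  ("\<omega>") where "\<omega> \<equiv> omega mem"
abbreviation nat0  ("\<zero>") where "\<zero> \<equiv> emptyset mem"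
abbreviation sc  ("\<ss>") where "\<ss> n \<equiv> succ mem n"
abbreviation nat1  ("\<one>") where "\<one> \<equiv> \<ss> \<zero>"
abbreviation nat2  ("\<two>") where "\<two> \<equiv> \<ss> \<one>"
abbreviation ev where "ev n \<equiv> even_nat mem n"

section \<open>Sets, pairs and functions in the model\<close>

lemma ext: "(\<And>z. z \<epsilon> x \<longleftrightarrow> z \<epsilon> y) \<Longrightarrow> x = y"
  using model unfolding ZF_model_def extensionality_def by blast

lemma ext_iff: "x = y \<longleftrightarrow> (\<forall>z. z \<epsilon> x \<longleftrightarrow> z \<epsilon> y)"
  using ext by blast

lemma in_setof:
  assumes "\<exists>s. \<forall>x. x \<epsilon> s \<longleftrightarrow> P x"
  shows "x \<epsilon> setof mem P \<longleftrightarrow> P x"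
proof -
  obtain s where s: "\<forall>x. x \<epsilon> s \<longleftrightarrow> P x" using assms by blast
  then have "setof mem P = s"
    unfolding setof_def by (rule the_equality) (use s in \<open>auto intro: ext\<close>)
  then show ?thesis using s by simp
qed

lemma ex_bounded:
  assumes "dP (\<lambda>e. P (e 0))" "\<And>x. P x \<Longrightarrow> x \<epsilon> B"
  shows "\<exists>s. \<forall>x. x \<epsilon> s \<longleftrightarrow> P x"
  using ex_separation[OF assms(1), of B] assms(2) by blast

lemma in_upair [simp]: "z \<epsilon> upair mem x y \<longleftrightarrow> z = x \<or> z = y"
  unfolding upair_def using model by (subst in_setof) (auto simp: ZF_model_def pairing_def)

lemma pair_inject [simp]: "\<langle>x, y\<rangle> = \<langle>x', y'\<rangle> \<longleftrightarrow> x = x' \<and> y = y'"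
proof -
  have eq: "upair mem a b = upair mem c d \<longleftrightarrow> a = c \<and> b = d \<or> a = d \<and> b = c" for a b c d
    by (subst ext_iff) auto
  show ?thesis unfolding pair_def by (auto simp: eq)
qed

lemma ex_union: "\<exists>u. \<forall>z. z \<epsilon> u \<longleftrightarrow> (\<exists>y. y \<epsilon> x \<and> z \<epsilon> y)"
  using model by (simp add: ZF_model_def union_def)

lemma ex_power: "\<exists>p. \<forall>z. z \<epsilon> p \<longleftrightarrow> (\<forall>y. y \<epsilon> z \<longrightarrow> y \<epsilon> x)"
  using model by (simp add: ZF_model_def powerset_def)

lemma ex_binunion: "\<exists>u. \<forall>z. z \<epsilon> u \<longleftrightarrow> z \<epsilon> x \<or> z \<epsilon> y"
  using ex_union[of "upair mem x y"] by auto

lemma in_emptyset [simp]: "\<not> x \<epsilon> \<zero>"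
  unfolding emptyset_def using ex_separation[OF dP_bool[of False]] by (subst in_setof) auto

lemma in_succ [simp]: "x \<epsilon> \<ss> n \<longleftrightarrow> x \<epsilon> n \<or> x = n"
  unfolding succ_def using ex_binunion[of n "upair mem n n"] by (subst in_setof) auto

text \<open>Pattern for all set-forming operations: by extensionality the graph becomes a condition
  on elements, to which the rules \<open>dfn\<close> apply.\<close>

lemma dT_upair: "dT t \<Longrightarrow> dT u \<Longrightarrow> dT (\<lambda>e. upair mem (t e) (u e))"
  by (rule dT_fun2) (subst ext_iff, unfold in_upair, intro dfn)

lemma dT_pair: "dT t \<Longrightarrow> dT u \<Longrightarrow> dT (\<lambda>e. \<langle>t e, u e\<rangle>)"
  unfolding pair_def by (intro dT_upair)

lemma dT_succ: "dT t \<Longrightarrow> dT (\<lambda>e. \<ss> (t e))"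
  by (rule dT_fun1) (subst ext_iff, unfold in_succ, intro dfn)

text \<open>The components of a Kuratowski pair are elements of its elements, so two unions over
  \<open>f\<close> collect them. This bounds \<open>app\<close>, whose values have no codomain given
  in advance.\<close>

lemma ex_field: "\<exists>U. \<forall>x y. \<langle>x, y\<rangle> \<epsilon> f \<longrightarrow> x \<epsilon> U \<and> y \<epsilon> U"
proof -
  obtain u where u: "\<And>z. z \<epsilon> u \<longleftrightarrow> (\<exists>y. y \<epsilon> f \<and> z \<epsilon> y)" using ex_union by metis
  obtain v where v: "\<And>z. z \<epsilon> v \<longleftrightarrow> (\<exists>y. y \<epsilon> u \<and> z \<epsilon> y)" using ex_union by metis
  have "x \<epsilon> v \<and> y \<epsilon> v" if "\<langle>x, y\<rangle> \<epsilon> f" for x y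
    unfolding v u using that in_upair unfolding pair_def by metis
  then show ?thesis by blast
qed

lemma in_app: "z \<epsilon> f \<cdot> x \<longleftrightarrow> (\<exists>y. \<langle>x, y\<rangle> \<epsilon> f \<and> z \<epsilon> y)"
proof -
  obtain U where U: "\<And>x y. \<langle>x, y\<rangle> \<epsilon> f \<Longrightarrow> y \<epsilon> U" using ex_field by blast
  obtain V where V: "\<And>z. z \<epsilon> V \<longleftrightarrow> (\<exists>y. y \<epsilon> U \<and> z \<epsilon> y)" using ex_union by blast
  show ?thesis unfolding app_def
    by (rule in_setof, rule ex_bounded[of _ V], intro dfn dT_pair) (use U V in blast)
qed

lemma in_restr: "p \<epsilon> f \<restriction> A \<longleftrightarrow> p \<epsilon> f \<and> (\<exists>x y. x \<epsilon> A \<and> p = \<langle>x, y\<rangle>)"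
  unfolding restr_def by (rule in_setof, rule ex_bounded[of _ f], intro dfn dT_pair) blast

lemma dT_app: "dT t \<Longrightarrow> dT u \<Longrightarrow> dT (\<lambda>e. t e \<cdot> u e)"
  by (rule dT_fun2) (subst ext_iff, unfold in_app, intro dfn dT_pair)

lemma dT_restr: "dT t \<Longrightarrow> dT u \<Longrightarrow> dT (\<lambda>e. t e \<restriction> u e)"
  by (rule dT_fun2) (subst ext_iff, unfold in_restr, intro dfn dT_pair)

lemma in_cart: "p \<epsilon> cart mem A B \<longleftrightarrow> (\<exists>x y. x \<epsilon> A \<and> y \<epsilon> B \<and> p = \<langle>x, y\<rangle>)"
proof -
  obtain U where U: "\<And>z. z \<epsilon> U \<longleftrightarrow> z \<epsilon> A \<or> z \<epsilon> B" using ex_binunion by blast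
  obtain V where V: "\<And>z. z \<epsilon> V \<longleftrightarrow> (\<forall>y. y \<epsilon> z \<longrightarrow> y \<epsilon> U)" using ex_power by blast
  obtain W where W: "\<And>z. z \<epsilon> W \<longleftrightarrow> (\<forall>y. y \<epsilon> z \<longrightarrow> y \<epsilon> V)" using ex_power by blast
  show ?thesis unfolding cart_def
    by (rule in_setof, rule ex_bounded[of _ W], intro dfn dT_pair) (auto simp: U V W pair_def)
qed

lemma function_on_pair:
  assumes "function_on mem f A" "x \<epsilon> A"
  shows "\<langle>x, y\<rangle> \<epsilon> f \<longleftrightarrow> y = f \<cdot> x"
proof -
  obtain z where z: "\<And>y. \<langle>x, y\<rangle> \<epsilon> f \<longleftrightarrow> y = z"
    using assms unfolding function_on_def by metis
  then have "f \<cdot> x = z" by (intro ext) (simp add: in_app)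
  then show ?thesis using z by simp
qed

lemma in_function:
  assumes "function_on mem f A"
  shows "p \<epsilon> f \<longleftrightarrow> (\<exists>x. x \<epsilon> A \<and> p = \<langle>x, f \<cdot> x\<rangle>)"
proof
  assume p: "p \<epsilon> f"
  then obtain x y where "x \<epsilon> A" "p = \<langle>x, y\<rangle>" using assms unfolding function_on_def by blast
  then show "\<exists>x. x \<epsilon> A \<and> p = \<langle>x, f \<cdot> x\<rangle>" using function_on_pair[OF assms] p by auto
next
  assume "\<exists>x. x \<epsilon> A \<and> p = \<langle>x, f \<cdot> x\<rangle>"
  then show "p \<epsilon> f" using function_on_pair[OF assms] by auto
qed

lemma function_ext:
  assumes "function_on mem f A" "function_on mem g A" "\<And>x. x \<epsilon> A \<Longrightarrow> f \<cdot> x = g \<cdot> x"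
  shows "f = g"
  by (rule ext) (use assms(3) in \<open>auto simp: in_function[OF assms(1)] in_function[OF assms(2)]\<close>)

lemma mapsD:
  assumes "maps mem f A B"
  shows "function_on mem f A" "\<And>x. x \<epsilon> A \<Longrightarrow> f \<cdot> x \<epsilon> B"
  using assms unfolding maps_def by auto

lemma maps_ext:
  assumes "maps mem f A B" "maps mem g A C" "\<And>x. x \<epsilon> A \<Longrightarrow> f \<cdot> x = g \<cdot> x"
  shows "f = g"
  using function_ext mapsD assms by metis

lemma maps_in_cart: "maps mem f A B \<Longrightarrow> p \<epsilon> f \<Longrightarrow> p \<epsilon> cart mem A B"
  unfolding maps_def in_cart by (auto simp: in_function)

lemma ex_maps:
  assumes "dP (\<lambda>e. P (e 0))" "\<And>x. P x \<Longrightarrow> maps mem x A B"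
  shows "\<exists>s. \<forall>x. x \<epsilon> s \<longleftrightarrow> P x"
proof -
  obtain V where "\<And>z. z \<epsilon> V \<longleftrightarrow> (\<forall>y. y \<epsilon> z \<longrightarrow> y \<epsilon> cart mem A B)" using ex_power by metis
  then show ?thesis
    using maps_in_cart assms(2) by (intro ex_bounded[OF assms(1), of V]) blast
qed

text \<open>Unique existence stands in for choice: replacement turns the relation itself into the
  graph.\<close>

lemma ex_function:
  assumes "dP (\<lambda>e. Q (e 0) (e (Suc 0)))" "\<And>x. x \<epsilon> A \<Longrightarrow> \<exists>!y. Q x y"
  shows "\<exists>f. function_on mem f A \<and> (\<forall>x. x \<epsilon> A \<longrightarrow> Q x (f \<cdot> x))"
proof -
  have "dP (\<lambda>e. \<exists>y. Q (e 0) y \<and> e (Suc 0) = \<langle>e 0, y\<rangle>)"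
    by (intro dfn dT_pair dP_subst2[of Q, OF assms(1)])
  then have "\<exists>f. \<forall>p. p \<epsilon> f \<longleftrightarrow> (\<exists>x. x \<epsilon> A \<and> (\<exists>y. Q x y \<and> p = \<langle>x, y\<rangle>))"
    by (rule ex_replacement) (use assms(2) in blast)
  then obtain f where f: "\<And>p. p \<epsilon> f \<longleftrightarrow> (\<exists>x. x \<epsilon> A \<and> (\<exists>y. Q x y \<and> p = \<langle>x, y\<rangle>))"
    by blast
  have "function_on mem f A"
    unfolding function_on_def f using assms(2) by fastforce
  moreover have "Q x (f \<cdot> x)" if "x \<epsilon> A" for x
    using function_on_pair[OF calculation that, of "f \<cdot> x"] f by auto
  ultimately show ?thesis by blast
qed

lemma ex_lam:
  assumes "dP (\<lambda>e. e (Suc 0) = h (e 0))" "\<And>x. x \<epsilon> A \<Longrightarrow> h x \<epsilon> B"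
  shows "\<exists>f. maps mem f A B \<and> (\<forall>x. x \<epsilon> A \<longrightarrow> f \<cdot> x = h x)"
  using ex_function[of "\<lambda>x y. y = h x" A, OF assms(1)] assms(2) unfolding maps_def by metis

lemma restr_maps:
  assumes "maps mem f A B" "\<And>x. x \<epsilon> C \<Longrightarrow> x \<epsilon> A"
  shows "maps mem (f \<restriction> C) C B" "\<And>x. x \<epsilon> C \<Longrightarrow> f \<restriction> C \<cdot> x = f \<cdot> x"
proof -
  have pr: "\<langle>x, y\<rangle> \<epsilon> f \<restriction> C \<longleftrightarrow> x \<epsilon> C \<and> y = f \<cdot> x" for x y
    unfolding in_restr using function_on_pair[OF mapsD(1)[OF assms(1)]] assms(2) by auto
  then have fn: "function_on mem (f \<restriction> C) C"
    unfolding function_on_def pr by (auto simp: in_restr)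
  show *: "f \<restriction> C \<cdot> x = f \<cdot> x" if "x \<epsilon> C" for x
    using function_on_pair[OF fn that] pr that by auto
  show "maps mem (f \<restriction> C) C B"
    unfolding maps_def using fn * mapsD(2)[OF assms(1)] assms(2) by simp
qed

lemma restr_eq:
  assumes "maps mem f A B" "maps mem g A' B'" "\<And>x. x \<epsilon> C \<Longrightarrow> x \<epsilon> A" "\<And>x. x \<epsilon> C \<Longrightarrow> x \<epsilon> A'"
    and "\<And>x. x \<epsilon> C \<Longrightarrow> f \<cdot> x = g \<cdot> x"
  shows "f \<restriction> C = g \<restriction> C"
  using maps_ext[OF restr_maps(1)[OF assms(1,3)] restr_maps(1)[OF assms(2,4)]]
    restr_maps(2)[OF assms(1,3)] restr_maps(2)[OF assms(2,4)] assms(5) by simp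

lemma dP_function_on: "dT t \<Longrightarrow> dT u \<Longrightarrow> dP (\<lambda>e. function_on mem (t e) (u e))"
  by (rule dP_subst2[of "function_on mem"])
    (unfold function_on_def Ex1_def, intro dfn dT_pair)

lemma dP_maps: "dT t \<Longrightarrow> dT u \<Longrightarrow> dT v \<Longrightarrow> dP (\<lambda>e. maps mem (t e) (u e) (v e))"
  by (rule dP_subst3[of "maps mem"]) (unfold maps_def, intro dfn dT_app dP_function_on)

section \<open>Natural numbers of the model\<close>

lemma omega_iff: "n \<epsilon> \<omega> \<longleftrightarrow> (\<forall>I. \<zero> \<epsilon> I \<and> (\<forall>k. k \<epsilon> I \<longrightarrow> \<ss> k \<epsilon> I) \<longrightarrow> n \<epsilon> I)"
proof -
  have "infinity mem" using model by (simp add: ZF_model_def)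
  then obtain I z where z: "z \<epsilon> I" "\<And>x. \<not> x \<epsilon> z"
    and s: "\<And>x. x \<epsilon> I \<Longrightarrow> (\<exists>y. y \<epsilon> I \<and> (\<forall>z. z \<epsilon> y \<longleftrightarrow> z \<epsilon> x \<or> z = x))"
    unfolding infinity_def by blast
  have "\<zero> \<epsilon> I" using z by (metis ext in_emptyset)
  moreover have "\<ss> k \<epsilon> I" if "k \<epsilon> I" for k
    using s[OF that] by (metis ext in_succ)
  ultimately show ?thesis unfolding omega_def
    by (intro in_setof ex_bounded[of _ I] dfn dT_succ) blast
qed

lemma zero_omega [simp]: "\<zero> \<epsilon> \<omega>" and succ_omega [simp]: "n \<epsilon> \<omega> \<Longrightarrow> \<ss> n \<epsilon> \<omega>"
  by (simp_all add: omega_iff)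

text \<open>The case \<open>definable\<close> reflects that a model with nonstandard numbers admits
  induction only for predicates that separation can turn into a set.\<close>

lemma omega_induct [consumes 1, case_names definable zero succ]:
  assumes "n \<epsilon> \<omega>" "dP (\<lambda>e. P (e 0))" "P \<zero>" "\<And>k. k \<epsilon> \<omega> \<Longrightarrow> P k \<Longrightarrow> P (\<ss> k)"
  shows "P n"
proof -
  obtain I where "\<And>x. x \<epsilon> I \<longleftrightarrow> x \<epsilon> \<omega> \<and> P x" using ex_separation[OF assms(2)] by blast
  then show ?thesis using assms(1)[unfolded omega_iff, rule_format, of I] assms(3,4) by auto
qed

lemma omega_trans: assumes "n \<epsilon> \<omega>" "k \<epsilon> n" shows "k \<epsilon> \<omega>"
proof -
  have "\<forall>k. k \<epsilon> n \<longrightarrow> k \<epsilon> \<omega>"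
    using assms(1) by (induction rule: omega_induct) (intro dfn, auto)
  then show ?thesis using assms(2) by blast
qed

lemma less_trans: assumes "n \<epsilon> \<omega>" "k \<epsilon> n" "j \<epsilon> k" shows "j \<epsilon> n"
proof -
  have "\<forall>k j. k \<epsilon> n \<longrightarrow> j \<epsilon> k \<longrightarrow> j \<epsilon> n"
    using assms(1) by (induction rule: omega_induct) (intro dfn, auto)
  then show ?thesis using assms(2,3) by blast
qed

text \<open>Foundation, applied to the subset that separation cuts out of \<open>A\<close>;
  \<open>\<epsilon>\<close> need not be well-founded from outside.\<close>

lemma ex_minimal:
  assumes "P n" "n \<epsilon> A" "dP (\<lambda>e. P (e 0))"
  shows "\<exists>k. k \<epsilon> A \<and> P k \<and> (\<forall>j. j \<epsilon> A \<and> j \<epsilon> k \<longrightarrow> \<not> P j)"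
proof -
  obtain I where I: "\<And>x. x \<epsilon> I \<longleftrightarrow> x \<epsilon> A \<and> P x" using ex_separation[OF assms(3)] by blast
  have "\<exists>y. y \<epsilon> I \<and> \<not> (\<exists>z. z \<epsilon> I \<and> z \<epsilon> y)"
    using model assms(1,2) I unfolding ZF_model_def foundation_def by metis
  then show ?thesis using I by blast
qed

lemma omega_less_induct [consumes 1, case_names definable less]:
  assumes "n \<epsilon> \<omega>" "dP (\<lambda>e. P (e 0))" "\<And>k. k \<epsilon> \<omega> \<Longrightarrow> (\<And>j. j \<epsilon> k \<Longrightarrow> P j) \<Longrightarrow> P k"
  shows "P n"
proof (rule ccontr)
  assume "\<not> P n"
  then obtain k where "k \<epsilon> \<omega>" "\<not> P k" "\<And>j. j \<epsilon> \<omega> \<Longrightarrow> j \<epsilon> k \<Longrightarrow> P j"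
    using ex_minimal[of "\<lambda>n. \<not> P n", OF _ assms(1) dP_not[OF assms(2)]] by blast
  then show False using assms(3) omega_trans by blast
qed

lemma less_irrefl [simp]: "\<not> n \<epsilon> n"
proof
  assume "n \<epsilon> n"
  have "dP (\<lambda>e. e 0 = n)" by (intro dfn)
  from ex_minimal[of "\<lambda>x. x = n", OF refl _ this] \<open>n \<epsilon> n\<close>
  show False by (metis in_upair)
qed

lemma less_asym: "n \<epsilon> \<omega> \<Longrightarrow> k \<epsilon> n \<Longrightarrow> \<not> n \<epsilon> k"
  using less_trans less_irrefl by blast

lemma succ_less_succ: assumes "n \<epsilon> \<omega>" "k \<epsilon> n" shows "\<ss> k \<epsilon> \<ss> n"
proof -
  have "\<forall>k. k \<epsilon> n \<longrightarrow> \<ss> k \<epsilon> \<ss> n"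
    using assms(1) by (induction rule: omega_induct) (intro dfn dT_succ, auto)
  then show ?thesis using assms(2) by blast
qed

lemma less_linear: assumes "n \<epsilon> \<omega>" "k \<epsilon> \<omega>" shows "n \<epsilon> k \<or> n = k \<or> k \<epsilon> n"
proof -
  have 0: "\<zero> \<epsilon> \<ss> m" if "m \<epsilon> \<omega>" for m
    using that by (induction rule: omega_induct) (intro dfn dT_succ, auto)
  have "\<forall>k. k \<epsilon> \<omega> \<longrightarrow> n \<epsilon> k \<or> n = k \<or> k \<epsilon> n"
    using assms(1)
  proof (induction rule: omega_induct)
    case definable show ?case by (intro dfn)
  next
    case zero
    have "\<zero> \<epsilon> \<ss> k" if "k \<epsilon> \<omega>" for k using 0 that .
    then show ?case by auto
  next
    case (succ m)
    show ?case
    proof (intro allI impI)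
      fix k assume k: "k \<epsilon> \<omega>"
      then consider "m \<epsilon> k" | "m = k" | "k \<epsilon> m" using succ by blast
      then show "\<ss> m \<epsilon> k \<or> \<ss> m = k \<or> k \<epsilon> \<ss> m"
        by cases (use succ_less_succ[OF k, of m] in auto)
    qed
  qed
  then show ?thesis using assms(2) by blast
qed

lemma succ_inject [simp]: "n \<epsilon> \<omega> \<Longrightarrow> k \<epsilon> \<omega> \<Longrightarrow> \<ss> n = \<ss> k \<longleftrightarrow> n = k"
  using less_asym in_succ by metis

lemma zero_neq_succ [simp]: "\<zero> \<noteq> \<ss> n" "\<ss> n \<noteq> \<zero>"
  using in_emptyset in_succ by metis+

lemma omega_cases:
  assumes "n \<epsilon> \<omega>" obtains "n = \<zero>" | k where "k \<epsilon> \<omega>" "n = \<ss> k"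
proof -
  have "n = \<zero> \<or> (\<exists>k. k \<epsilon> \<omega> \<and> n = \<ss> k)"
    using assms by (induction rule: omega_induct) (intro dfn dT_succ, auto)
  then show ?thesis using that by blast
qed

text \<open>The predecessor of a successor is its union.\<close>

definition pred :: "'v \<Rightarrow> 'v" where
  "pred n = setof mem (\<lambda>z. \<exists>y. y \<epsilon> n \<and> z \<epsilon> y)"

lemma in_pred: "z \<epsilon> pred n \<longleftrightarrow> (\<exists>y. y \<epsilon> n \<and> z \<epsilon> y)"
  unfolding pred_def using ex_union by (rule in_setof)

lemma dT_pred: "dT t \<Longrightarrow> dT (\<lambda>e. pred (t e))"
  by (rule dT_fun1) (subst ext_iff, unfold in_pred, intro dfn)

lemma pred_succ [simp]: "n \<epsilon> \<omega> \<Longrightarrow> pred (\<ss> n) = n"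
  by (rule ext) (auto simp: in_pred intro: less_trans)

section \<open>Recursion on the internal natural numbers\<close>

lemma ex_recursion:
  assumes G: "dP (\<lambda>e. e (Suc (Suc 0)) = G (e 0) (e (Suc 0)))"
    and A: "\<And>n s. n \<epsilon> \<omega> \<Longrightarrow> maps mem s n A \<Longrightarrow> G n s \<epsilon> A"
  shows "\<exists>z. maps mem z \<omega> A \<and> (\<forall>n. n \<epsilon> \<omega> \<longrightarrow> z \<cdot> n = G n (z \<restriction> n))"
proof -
  \<comment> \<open>\<open>ap n s\<close>: the tuple \<open>s\<close> of length \<open>n\<close> is
    an initial segment of the sequence to be built. Such segments exist for each \<open>n\<close> by
    induction and agree where both are defined, so they can be glued together.\<close>
  define ap where "ap n s \<longleftrightarrow> maps mem s n A \<and> (\<forall>k. k \<epsilon> n \<longrightarrow> s \<cdot> k = G k (s \<restriction> k))" for n s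
  note dG = dT_fun2[OF G]
  have dap: "dP (\<lambda>e. ap (t e) (u e))" if "dT t" "dT u" for t u
    by (rule dP_subst2[of ap, OF _ that]) (unfold ap_def, intro dfn dP_maps dT_app dT_restr dG)
  have uniq: "s \<cdot> k = t \<cdot> k" if "ap n s" "ap m t" "n \<epsilon> \<omega>" "m \<epsilon> \<omega>" "k \<epsilon> n" "k \<epsilon> m" for n m s t k
  proof -
    have "k \<epsilon> \<omega>" using omega_trans that by blast
    then have "k \<epsilon> n \<longrightarrow> k \<epsilon> m \<longrightarrow> s \<cdot> k = t \<cdot> k"
    proof (induction rule: omega_less_induct)
      case definable show ?case by (intro dfn dT_app)
    next
      case (less k)
      have "s \<restriction> k = t \<restriction> k" if "k \<epsilon> n" "k \<epsilon> m"
        using less that \<open>ap n s\<close> \<open>ap m t\<close> less_trans \<open>n \<epsilon> \<omega>\<close> \<open>m \<epsilon> \<omega>\<close> unfolding ap_def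
        by (intro restr_eq[of s n A t m A k]) blast+
      then show ?case using \<open>ap n s\<close> \<open>ap m t\<close> unfolding ap_def by auto
    qed
    then show ?thesis using that by blast
  qed
  have ex: "\<exists>s. ap n s" if "n \<epsilon> \<omega>" for n
    using that
  proof (induction rule: omega_induct)
    case definable show ?case by (intro dfn dap)
  next
    case zero
    show ?case by (rule exI[of _ \<zero>]) (simp add: ap_def maps_def function_on_def)
  next
    case (succ n)
    then obtain s where s: "ap n s" by blast
    then have m: "maps mem s n A" unfolding ap_def by blast
    have "\<exists>t. maps mem t (\<ss> n) A \<and> (\<forall>k. k \<epsilon> \<ss> n \<longrightarrow> t \<cdot> k = (if k = n then G n s else s \<cdot> k))"
      by (rule ex_lam, intro dfn dT_app) (use A[OF succ(1) m] mapsD[OF m] in auto)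
    then obtain t where t: "maps mem t (\<ss> n) A"
      "\<And>k. k \<epsilon> \<ss> n \<Longrightarrow> t \<cdot> k = (if k = n then G n s else s \<cdot> k)" by blast
    have "t \<restriction> k = s \<restriction> k" if "k \<epsilon> \<ss> n" for k
    proof (rule restr_eq[OF t(1) m])
      have *: "x \<epsilon> n" if "x \<epsilon> k" for x using \<open>k \<epsilon> \<ss> n\<close> that less_trans[OF succ(1)] by auto
      show "x \<epsilon> \<ss> n" "x \<epsilon> n" "t \<cdot> x = s \<cdot> x" if "x \<epsilon> k" for x
        using that *[of x] t(2)[of x] less_irrefl[of n] by auto
    qed
    moreover have "s \<restriction> n = s"
      using restr_maps[OF m] by (intro maps_ext[OF _ m]) auto
    ultimately have "ap (\<ss> n) t" using t s unfolding ap_def by auto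
    then show ?case by blast
  qed
  \<comment> \<open>The value at \<open>n\<close> needs a segment of length n + 1; by
    \<open>uniq\<close> it does not depend on which one.\<close>
  define Q where "Q n y \<longleftrightarrow> (\<exists>s. ap (\<ss> n) s \<and> y = s \<cdot> n)" for n y
  have "\<exists>z. function_on mem z \<omega> \<and> (\<forall>n. n \<epsilon> \<omega> \<longrightarrow> Q n (z \<cdot> n))"
  proof (rule ex_function)
    show "dP (\<lambda>e. Q (e 0) (e (Suc 0)))" unfolding Q_def by (intro dfn dap dT_succ dT_app)
    show "\<exists>!y. Q n y" if "n \<epsilon> \<omega>" for n
      using ex[of "\<ss> n"] that uniq[of "\<ss> n" _ "\<ss> n"] unfolding Q_def by auto
  qed
  then obtain z where z: "function_on mem z \<omega>" "\<And>n. n \<epsilon> \<omega> \<Longrightarrow> Q n (z \<cdot> n)" by blast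
  have "Q n y \<Longrightarrow> n \<epsilon> \<omega> \<Longrightarrow> y \<epsilon> A" for n y
    unfolding Q_def ap_def using mapsD(2)[of _ "\<ss> n" A n] in_succ by blast
  then have mz: "maps mem z \<omega> A" using z unfolding maps_def by auto
  have "z \<cdot> n = G n (z \<restriction> n)" if n: "n \<epsilon> \<omega>" for n
  proof -
    obtain s where s: "ap (\<ss> n) s" "z \<cdot> n = s \<cdot> n" using z n unfolding Q_def by blast
    have "z \<cdot> k = s \<cdot> k" if k: "k \<epsilon> n" for k
    proof -
      have "k \<epsilon> \<omega>" using omega_trans n k by blast
      then obtain t where "ap (\<ss> k) t" "z \<cdot> k = t \<cdot> k" using z unfolding Q_def by blast
      then show ?thesis using uniq[of "\<ss> k" t "\<ss> n" s k] s \<open>k \<epsilon> \<omega>\<close> n k by auto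
    qed
    then have "z \<restriction> n = s \<restriction> n"
      using s(1) n omega_trans unfolding ap_def by (intro restr_eq[OF mz, of s "\<ss> n" A]) auto
    then show ?thesis using s unfolding ap_def by auto
  qed
  then show ?thesis using mz by blast
qed

lemma ex_iteration:
  assumes T: "dP (\<lambda>e. e (Suc (Suc 0)) = T (e 0) (e (Suc 0)))"
    and "c \<epsilon> A" "\<And>n x. n \<epsilon> \<omega> \<Longrightarrow> x \<epsilon> A \<Longrightarrow> T n x \<epsilon> A"
  shows "\<exists>z. maps mem z \<omega> A \<and> z \<cdot> \<zero> = c \<and> (\<forall>n. n \<epsilon> \<omega> \<longrightarrow> z \<cdot> \<ss> n = T n (z \<cdot> n))"
proof -
  define G where "G n s = (if n = \<zero> then c else T (pred n) (s \<cdot> pred n))" for n s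
  have "\<exists>z. maps mem z \<omega> A \<and> (\<forall>n. n \<epsilon> \<omega> \<longrightarrow> z \<cdot> n = G n (z \<restriction> n))"
  proof (rule ex_recursion)
    show "dP (\<lambda>e. e (Suc (Suc 0)) = G (e 0) (e (Suc 0)))"
      unfolding G_def by (intro dfn dT_fun2[OF T] dT_pred dT_app)
    show "G n s \<epsilon> A" if "n \<epsilon> \<omega>" "maps mem s n A" for n s
      using that(1) by (cases rule: omega_cases) (use assms(2,3) mapsD[OF that(2)] in \<open>auto simp: G_def\<close>)
  qed
  then obtain z where z: "maps mem z \<omega> A" "\<And>n. n \<epsilon> \<omega> \<Longrightarrow> z \<cdot> n = G n (z \<restriction> n)" by blast
  have "z \<cdot> \<ss> n = T n (z \<cdot> n)" if "n \<epsilon> \<omega>" for n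
  proof -
    have "z \<restriction> \<ss> n \<cdot> n = z \<cdot> n"
      by (rule restr_maps(2)[OF z(1)]) (use that omega_trans in auto)
    then show ?thesis
      using z(2)[OF succ_omega[OF that]] that by (simp add: G_def)
  qed
  then show ?thesis using z by (intro exI[of _ z]) (auto simp: G_def)
qed

section \<open>Parity\<close>

lemma even_unique:
  assumes "n \<epsilon> \<omega>" "\<zero> \<epsilon> D" "\<forall>k. k \<epsilon> \<omega> \<longrightarrow> (\<ss> k \<epsilon> D \<longleftrightarrow> \<not> k \<epsilon> D)"
    "\<zero> \<epsilon> E" "\<forall>k. k \<epsilon> \<omega> \<longrightarrow> (\<ss> k \<epsilon> E \<longleftrightarrow> \<not> k \<epsilon> E)"
  shows "n \<epsilon> D \<longleftrightarrow> n \<epsilon> E"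
  using assms(1) by (induction rule: omega_induct) (intro dfn, use assms in auto)

lemma ev_zero [simp]: "ev \<zero>" and ev_succ [simp]: "n \<epsilon> \<omega> \<Longrightarrow> ev (\<ss> n) \<longleftrightarrow> \<not> ev n"
proof -
  \<comment> \<open>An alternating sequence of 0 and 1; its zeros form a set as
    \<open>even_nat\<close> asks for, and \<open>even_unique\<close> shows that all such sets have
    the same members in \<open>\<omega>\<close>.\<close>
  have "\<exists>z. maps mem z \<omega> \<omega> \<and> z \<cdot> \<zero> = \<zero> \<and>
    (\<forall>n. n \<epsilon> \<omega> \<longrightarrow> z \<cdot> \<ss> n = (if z \<cdot> n = \<zero> then \<one> else \<zero>))"
    by (rule ex_iteration[of "\<lambda>n x. if x = \<zero> then \<one> else \<zero>"]) (intro dfn, auto)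
  then obtain z where z: "z \<cdot> \<zero> = \<zero>"
    "\<And>n. n \<epsilon> \<omega> \<Longrightarrow> z \<cdot> \<ss> n = (if z \<cdot> n = \<zero> then \<one> else \<zero>)" by blast
  have "dP (\<lambda>e. z \<cdot> e 0 = \<zero>)" by (intro dfn dT_app)
  from ex_separation[OF this] obtain D where D: "\<And>n. n \<epsilon> D \<longleftrightarrow> n \<epsilon> \<omega> \<and> z \<cdot> n = \<zero>" by metis
  have *: "\<zero> \<epsilon> D" "\<forall>k. k \<epsilon> \<omega> \<longrightarrow> (\<ss> k \<epsilon> D \<longleftrightarrow> \<not> k \<epsilon> D)" "subset_of mem D \<omega>"
    using z by (auto simp: D subset_of_def)
  have "ev n \<longleftrightarrow> n \<epsilon> D" if "n \<epsilon> \<omega>" for n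
    unfolding even_nat_def using even_unique[OF that _ _ *(1,2)] * by blast
  then show "ev \<zero>" "n \<epsilon> \<omega> \<Longrightarrow> ev (\<ss> n) \<longleftrightarrow> \<not> ev n" using * by auto
qed

lemma odd_cases:
  assumes "n \<epsilon> \<omega>" "\<not> ev n" obtains m where "m \<epsilon> \<omega>" "ev m" "n = \<ss> m"
  using assms by (cases rule: omega_cases) auto

lemma dP_subset_of: "dT t \<Longrightarrow> dT u \<Longrightarrow> dP (\<lambda>e. subset_of mem (t e) (u e))"
  by (rule dP_subst2[of "subset_of mem"]) (unfold subset_of_def, intro dfn)

lemma dP_ev: "dT t \<Longrightarrow> dP (\<lambda>e. ev (t e))"
  by (rule dP_subst1[of ev]) (unfold even_nat_def, intro dfn dP_subset_of dT_succ)

lemma in_finseqs: "s \<epsilon> finseqs mem A \<longleftrightarrow> (\<exists>n. n \<epsilon> \<omega> \<and> maps mem s n A)"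
  unfolding finseqs_def
proof -
  obtain V where V: "\<And>z. z \<epsilon> V \<longleftrightarrow> (\<forall>y. y \<epsilon> z \<longrightarrow> y \<epsilon> cart mem \<omega> A)" using ex_power by blast
  have "s \<epsilon> V" if "\<exists>n. n \<epsilon> \<omega> \<and> maps mem s n A" for s
    using that maps_in_cart unfolding V by (fastforce simp: in_cart dest: omega_trans)
  then show "s \<epsilon> setof mem (\<lambda>s. \<exists>n. n \<epsilon> \<omega> \<and> maps mem s n A) \<longleftrightarrow> (\<exists>n. n \<epsilon> \<omega> \<and> maps mem s n A)"
    by (intro in_setof ex_bounded[of _ V] dfn dP_maps)
qed

text \<open>Serves to query a strategy at a position not yet reached: the moves so far, followed by
  a hypothetical one.\<close>

definition snoc :: "'v \<Rightarrow> 'v \<Rightarrow> 'v \<Rightarrow> 'v" where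
  "snoc s n v = setof mem (\<lambda>p. p \<epsilon> s \<or> p = \<langle>n, v\<rangle>)"

lemma in_snoc: "p \<epsilon> snoc s n v \<longleftrightarrow> p \<epsilon> s \<or> p = \<langle>n, v\<rangle>"
  unfolding snoc_def using ex_binunion[of s "upair mem \<langle>n, v\<rangle> \<langle>n, v\<rangle>"] by (subst in_setof) auto

lemma dT_snoc: "dT t \<Longrightarrow> dT u \<Longrightarrow> dT (\<lambda>e. snoc (t e) (u e) v)"
  by (rule dT_fun2) (subst ext_iff, unfold in_snoc, intro dfn dT_pair)

lemma restr_succ: assumes "maps mem z \<omega> A" "n \<epsilon> \<omega>" shows "z \<restriction> \<ss> n = snoc (z \<restriction> n) n (z \<cdot> n)"
  using function_on_pair[OF mapsD(1)[OF assms(1)]] assms(2)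
  by (intro ext) (auto simp: in_snoc in_restr)

section \<open>Countability\<close>

text \<open>The least witness is the definable selection that replaces choosing one.\<close>

lemma ex1_least:
  assumes "dP (\<lambda>e. P (e 0))" "n \<epsilon> \<omega>" "P n"
  shows "\<exists>!n. n \<epsilon> \<omega> \<and> P n \<and> (\<forall>j. j \<epsilon> n \<longrightarrow> \<not> P j)"
proof -
  obtain k where k: "k \<epsilon> \<omega>" "P k" "\<And>j. j \<epsilon> \<omega> \<Longrightarrow> j \<epsilon> k \<Longrightarrow> \<not> P j"
    using ex_minimal[of P, OF assms(3,2,1)] by blast
  show ?thesis
  proof (rule ex1I[of _ k])
    show "k \<epsilon> \<omega> \<and> P k \<and> (\<forall>j. j \<epsilon> k \<longrightarrow> \<not> P j)" using k omega_trans by blast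
    show "m = k" if "m \<epsilon> \<omega> \<and> P m \<and> (\<forall>j. j \<epsilon> m \<longrightarrow> \<not> P j)" for m
      using that k less_linear[of m k] by blast
  qed
qed

text \<open>Ternary because the plays to be coded contain two prescribing moves and one open
  move.\<close>

definition digit :: "'v \<Rightarrow> bool" where
  "digit d \<longleftrightarrow> d = \<zero> \<or> d = \<one> \<or> d = \<two>"

definition add_digit :: "'v \<Rightarrow> 'v \<Rightarrow> 'v" where
  "add_digit n d = (if d = \<zero> then n else if d = \<one> then \<ss> n else \<ss> (\<ss> n))"

text \<open>\<open>T\<close> is multiplication by 3, and the clause is uniqueness of quotient and
  remainder: for m < n even 3m + 2 lies below 3n.\<close>

lemma ex_triple:
  "\<exists>T. maps mem T \<omega> \<omega> \<and> (\<forall>m n d e. m \<epsilon> \<omega> \<and> n \<epsilon> \<omega> \<and> digit d \<and> digit e \<and>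
     add_digit (T \<cdot> m) d = add_digit (T \<cdot> n) e \<longrightarrow> m = n \<and> d = e) \<and> T \<cdot> \<zero> = \<zero>"
proof -
  have "\<exists>T. maps mem T \<omega> \<omega> \<and> T \<cdot> \<zero> = \<zero> \<and> (\<forall>n. n \<epsilon> \<omega> \<longrightarrow> T \<cdot> \<ss> n = \<ss> (\<ss> (\<ss> (T \<cdot> n))))"
    by (rule ex_iteration[of "\<lambda>n x. \<ss> (\<ss> (\<ss> x))"]) (intro dfn dT_succ, auto simp del: in_succ)
  then obtain T where T: "maps mem T \<omega> \<omega>" "T \<cdot> \<zero> = \<zero>"
    "\<And>n. n \<epsilon> \<omega> \<Longrightarrow> T \<cdot> \<ss> n = \<ss> (\<ss> (\<ss> (T \<cdot> n)))" by blast
  note Tm = mapsD(2)[OF T(1)]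
  have mono: "\<forall>m. m \<epsilon> n \<longrightarrow> \<ss> (\<ss> (T \<cdot> m)) \<epsilon> T \<cdot> n" if "n \<epsilon> \<omega>" for n
    using that
  proof (induction rule: omega_induct)
    case definable show ?case by (intro dfn dT_succ dT_app)
  next
    case (succ n)
    then show ?case using T(3)[of n] by auto
  qed simp
  have less: "add_digit (T \<cdot> m) d \<noteq> add_digit (T \<cdot> n) e" if "n \<epsilon> \<omega>" "m \<epsilon> n" for m n d e
  proof
    assume eq: "add_digit (T \<cdot> m) d = add_digit (T \<cdot> n) e"
    have lt: "\<ss> (\<ss> (T \<cdot> m)) \<epsilon> T \<cdot> n" using mono that by blast
    have "add_digit (T \<cdot> m) d \<epsilon> \<ss> (\<ss> (\<ss> (T \<cdot> m)))" by (simp add: add_digit_def)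
    then have "add_digit (T \<cdot> m) d \<epsilon> T \<cdot> n"
      using lt less_trans[OF Tm[OF that(1)] lt] in_succ[of _ "\<ss> (\<ss> (T \<cdot> m))"] by metis
    then have "add_digit (T \<cdot> m) d \<epsilon> add_digit (T \<cdot> n) e"
      by (simp add: add_digit_def)
    then show False using eq by simp
  qed
  have "m = n \<and> d = e" if "m \<epsilon> \<omega>" "n \<epsilon> \<omega>" "digit d" "digit e"
    "add_digit (T \<cdot> m) d = add_digit (T \<cdot> n) e" for m n d e
  proof -
    have "m = n" using less less_linear that by metis
    moreover have "x \<noteq> \<ss> x" "x \<noteq> \<ss> (\<ss> x)" "\<ss> x \<noteq> x" "\<ss> (\<ss> x) \<noteq> x" for x using in_succ less_irrefl by metis+
    ultimately show ?thesis
      using that Tm[of n] unfolding digit_def add_digit_def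
      by (auto simp: simp del: in_succ split: if_splits)
  qed
  then show ?thesis using T by blast
qed

text \<open>The elements of \<open>A\<close> are coded by finite digit sequences, which are read as ternary numerals
  with leading digit 1.\<close>

lemma countable_by_digits:
  assumes R: "dP (\<lambda>e. Rl (e 0) (e (Suc 0)) (e (Suc (Suc 0))))"
    and ex: "\<And>x. x \<epsilon> A \<Longrightarrow> \<exists>d N. Rl x d N"
    and dig: "\<And>x d N. Rl x d N \<Longrightarrow> N \<epsilon> \<omega> \<and> (\<forall>k. k \<epsilon> \<omega> \<longrightarrow> digit (d \<cdot> k))"
    and inj: "\<And>x y d e N. Rl x d N \<Longrightarrow> Rl y e N \<Longrightarrow> (\<And>k. k \<epsilon> N \<Longrightarrow> d \<cdot> k = e \<cdot> k) \<Longrightarrow> x = y"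
  shows "countable_set mem A"
proof -
  obtain T where T: "maps mem T \<omega> \<omega>" "T \<cdot> \<zero> = \<zero>"
    and Tinj: "\<And>m n d e. m \<epsilon> \<omega> \<Longrightarrow> n \<epsilon> \<omega> \<Longrightarrow> digit d \<Longrightarrow> digit e \<Longrightarrow>
      add_digit (T \<cdot> m) d = add_digit (T \<cdot> n) e \<Longrightarrow> m = n \<and> d = e"
    using ex_triple by blast
  \<comment> \<open>\<open>s \<cdot> k\<close> is the numeral formed from the first \<open>k\<close>
    digits. The leading 1 makes leading zeros, and hence the length, visible in its value.\<close>
  define cd where "cd d s \<longleftrightarrow> maps mem s \<omega> \<omega> \<and> s \<cdot> \<zero> = \<one> \<and>
    (\<forall>k. k \<epsilon> \<omega> \<longrightarrow> s \<cdot> \<ss> k = add_digit (T \<cdot> (s \<cdot> k)) (d \<cdot> k))" for d s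
  define C where "C x c \<longleftrightarrow> (\<exists>d N s. Rl x d N \<and> cd d s \<and> c = s \<cdot> N)" for x c
  have dC: "dP (\<lambda>e. C (t e) (u e))" if "dT t" "dT u" for t u
    by (rule dP_subst2[of C, OF _ that])
      (unfold C_def cd_def add_digit_def, intro dfn dP_subst3[of Rl, OF R] dP_maps dT_app dT_succ)
  have pos: "s \<cdot> k \<noteq> \<zero>" if "cd d s" "k \<epsilon> \<omega>" "\<And>k. k \<epsilon> \<omega> \<Longrightarrow> digit (d \<cdot> k)" for d s k
    using that(2)
  proof (induction rule: omega_induct)
    case definable show ?case by (intro dfn dT_app)
  next
    case zero then show ?case using that(1) unfolding cd_def by auto
  next
    case (succ k)
    have "add_digit (T \<cdot> \<zero>) \<zero> = \<zero>" "digit \<zero>" using T(2) by (auto simp: add_digit_def digit_def)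
    then show ?case
      using Tinj[of "s \<cdot> k" \<zero> "d \<cdot> k" \<zero>] that(1,3) succ mapsD(2) unfolding cd_def by fastforce
  qed
  \<comment> \<open>The last digit and the numeral before it are remainder and quotient by 3, so
    induction on \<open>N\<close> recovers all digits and the length.\<close>
  have uniq: "\<forall>M. M \<epsilon> \<omega> \<and> s \<cdot> N = t \<cdot> M \<longrightarrow> N = M \<and> (\<forall>k. k \<epsilon> N \<longrightarrow> d \<cdot> k = e \<cdot> k)"
    if "cd d s" "cd e t" "N \<epsilon> \<omega>" and dig: "\<And>k. k \<epsilon> \<omega> \<Longrightarrow> digit (d \<cdot> k)" "\<And>k. k \<epsilon> \<omega> \<Longrightarrow> digit (e \<cdot> k)"
    for d s e t N
  proof -
    have one: "add_digit (T \<cdot> \<zero>) \<one> = \<one>" "digit \<one>"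
      using T(2) by (auto simp: add_digit_def digit_def)
    have step: "s \<cdot> \<ss> k = add_digit (T \<cdot> (s \<cdot> k)) (d \<cdot> k)" "s \<cdot> k \<epsilon> \<omega>" "s \<cdot> \<zero> = \<one>"
      if "cd d s" "k \<epsilon> \<omega>" for d s k
      using that mapsD(2) unfolding cd_def by auto
    \<comment> \<open>Since 1 = 3 * 0 + 1, only the numeral 0 could precede the value 1, and
      \<open>pos\<close> excludes it; thus the value 1 marks length 0.\<close>
    have not1: "s \<cdot> \<ss> k \<noteq> \<one>" if "cd d s" "k \<epsilon> \<omega>" "\<And>k. k \<epsilon> \<omega> \<Longrightarrow> digit (d \<cdot> k)" for d s k
      using Tinj[of "s \<cdot> k" \<zero> "d \<cdot> k" \<one>] step[of d s k] one pos[of d s k] that by auto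
    show ?thesis using \<open>N \<epsilon> \<omega>\<close>
    proof (induction rule: omega_induct)
      case definable show ?case by (intro dfn dT_app)
    next
      case zero
      show ?case
      proof (intro allI impI)
        fix M assume M: "M \<epsilon> \<omega> \<and> s \<cdot> \<zero> = t \<cdot> M"
        then have "M \<epsilon> \<omega>" by blast
        then have "M = \<zero>"
          by (cases rule: omega_cases) (use M step(3)[OF that(1,3)] not1[OF that(2) _ dig(2)] in auto)
        then show "\<zero> = M \<and> (\<forall>k. k \<epsilon> \<zero> \<longrightarrow> d \<cdot> k = e \<cdot> k)" by simp
      qed
    next
      case (succ N)
      show ?case
      proof (intro allI impI)
        fix M assume M: "M \<epsilon> \<omega> \<and> s \<cdot> \<ss> N = t \<cdot> M"
        then have "M \<epsilon> \<omega>" by blast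
        then show "\<ss> N = M \<and> (\<forall>k. k \<epsilon> \<ss> N \<longrightarrow> d \<cdot> k = e \<cdot> k)"
        proof (cases rule: omega_cases)
          case 1
          then show ?thesis
            using M step(3)[OF that(2) \<open>M \<epsilon> \<omega>\<close>] not1[OF that(1) succ(1) dig(1)] by simp
        next
          case (2 K)
          then show ?thesis
            using M succ Tinj[of "s \<cdot> N" "t \<cdot> K" "d \<cdot> N" "e \<cdot> K"] step[OF that(1) succ(1)]
              step[OF that(2) 2(1)] dig by auto
        qed
      qed
    qed
  qed
  have Cinj: "x = y" if "C x c" "C y c" for x y c
  proof -
    obtain d N s where 1: "Rl x d N" "cd d s" "c = s \<cdot> N" using \<open>C x c\<close> unfolding C_def by blast
    obtain e M t where 2: "Rl y e M" "cd e t" "c = t \<cdot> M" using \<open>C y c\<close> unfolding C_def by blast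
    have "N = M \<and> (\<forall>k. k \<epsilon> N \<longrightarrow> d \<cdot> k = e \<cdot> k)"
      using uniq[OF 1(2) 2(2)] dig[OF 1(1)] dig[OF 2(1)] 1(3) 2(3) by blast
    then show ?thesis using inj 1 2 by blast
  qed
  have Cex: "\<exists>c. c \<epsilon> \<omega> \<and> C x c" if x: "x \<epsilon> A" for x
  proof -
    obtain d N where d: "Rl x d N" using ex[OF x] by blast
    have "\<exists>s. maps mem s \<omega> \<omega> \<and> s \<cdot> \<zero> = \<one> \<and>
      (\<forall>k. k \<epsilon> \<omega> \<longrightarrow> s \<cdot> \<ss> k = (\<lambda>k x. add_digit (T \<cdot> x) (d \<cdot> k)) k (s \<cdot> k))"
      by (rule ex_iteration, unfold add_digit_def, intro dfn dT_app dT_succ)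
        (use mapsD(2)[OF T(1)] in \<open>auto simp del: in_succ\<close>)
    then obtain s where "cd d s" unfolding cd_def by blast
    moreover have "s \<cdot> N \<epsilon> \<omega>" using calculation dig[OF d] mapsD(2) unfolding cd_def by blast
    ultimately show ?thesis using d unfolding C_def by blast
  qed
  \<comment> \<open>One element can have many codes; taking the least one gives a function.\<close>
  define Q where "Q x c \<longleftrightarrow> c \<epsilon> \<omega> \<and> C x c \<and> (\<forall>j. j \<epsilon> c \<longrightarrow> \<not> C x j)" for x c
  have "\<exists>f. function_on mem f A \<and> (\<forall>x. x \<epsilon> A \<longrightarrow> Q x (f \<cdot> x))"
  proof (rule ex_function)
    show "dP (\<lambda>e. Q (e 0) (e (Suc 0)))" unfolding Q_def by (intro dfn dC)
    show "\<exists>!c. Q x c" if "x \<epsilon> A" for x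
    proof -
      have "dP (\<lambda>e. C x (e 0))" by (intro dC dfn)
      then show ?thesis using ex1_least[of "C x"] Cex[OF that] unfolding Q_def by blast
    qed
  qed
  then show ?thesis unfolding countable_set_def maps_def Q_def using Cinj by metis
qed

section \<open>A countable dense set of reals\<close>

text \<open>Given by the elements of the component, so that it is a set for every \<open>p\<close>
  (empty if \<open>p\<close> is no pair) and its definability reduces to extensionality.\<close>

definition pfst :: "'v \<Rightarrow> 'v" where
  "pfst p = setof mem (\<lambda>z. \<exists>x y. p = \<langle>x, y\<rangle> \<and> z \<epsilon> x)"

definition psnd :: "'v \<Rightarrow> 'v" where
  "psnd p = setof mem (\<lambda>z. \<exists>x y. p = \<langle>x, y\<rangle> \<and> z \<epsilon> y)"

lemma in_pfst: "z \<epsilon> pfst p \<longleftrightarrow> (\<exists>x y. p = \<langle>x, y\<rangle> \<and> z \<epsilon> x)"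
  and in_psnd: "z \<epsilon> psnd p \<longleftrightarrow> (\<exists>x y. p = \<langle>x, y\<rangle> \<and> z \<epsilon> y)"
proof -
  have "\<exists>s. \<forall>z. z \<epsilon> s \<longleftrightarrow> (\<exists>x y. p = \<langle>x, y\<rangle> \<and> z \<epsilon> x)" "\<exists>s. \<forall>z. z \<epsilon> s \<longleftrightarrow> (\<exists>x y. p = \<langle>x, y\<rangle> \<and> z \<epsilon> y)"
    by (cases "\<exists>x y. p = \<langle>x, y\<rangle>"; force intro: exI[of _ \<zero>])+
  note * = in_setof[OF this(1)] in_setof[OF this(2)]
  show "z \<epsilon> pfst p \<longleftrightarrow> (\<exists>x y. p = \<langle>x, y\<rangle> \<and> z \<epsilon> x)" "z \<epsilon> psnd p \<longleftrightarrow> (\<exists>x y. p = \<langle>x, y\<rangle> \<and> z \<epsilon> y)"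
    unfolding pfst_def psnd_def by (rule *)+
qed

lemma pfst_pair [simp]: "pfst \<langle>x, y\<rangle> = x" and psnd_pair [simp]: "psnd \<langle>x, y\<rangle> = y"
  by (rule ext; simp add: in_pfst in_psnd)+

lemma dT_pfst: "dT t \<Longrightarrow> dT (\<lambda>e. pfst (t e))"
  by (rule dT_fun1) (subst ext_iff, unfold in_pfst, intro dfn dT_pair)

lemma dT_psnd: "dT t \<Longrightarrow> dT (\<lambda>e. psnd (t e))"
  by (rule dT_fun1) (subst ext_iff, unfold in_psnd, intro dfn dT_pair)

end

section \<open>Order and arithmetic of the internal reals\<close>

locale zf_reals = zf mem for mem :: "'v \<Rightarrow> 'v \<Rightarrow> bool"  (infix "\<epsilon>" 50) +
  fixes R add mul lt zr one :: 'v
  assumes field: "complete_ordered_field mem R add mul lt zr one"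
begin

abbreviation less  (infix "\<prec>" 50) where "x \<prec> y \<equiv> less_in mem lt x y"
abbreviation leq  (infix "\<preceq>" 50) where "x \<preceq> y \<equiv> leq_in mem lt x y"
abbreviation plus  (infixl "\<oplus>" 65) where "x \<oplus> y \<equiv> op2 mem add x y"
abbreviation times  (infixl "\<odot>" 70) where "x \<odot> y \<equiv> op2 mem mul x y"

lemma nonzero_iff: "x \<epsilon> setof mem (\<lambda>x. x \<epsilon> R \<and> x \<noteq> zr) \<longleftrightarrow> x \<epsilon> R \<and> x \<noteq> zr"
  by (rule in_setof, rule ex_bounded[of _ R], intro dfn) blast

lemma field_axioms:
  "maps mem mul (cart mem R R) R" "subset_of mem lt (cart mem R R)"
  "zr \<epsilon> R" "\<forall>x y. x \<epsilon> R \<and> y \<epsilon> R \<longrightarrow> x \<oplus> y \<epsilon> R"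
  "\<forall>x y z. x \<epsilon> R \<and> y \<epsilon> R \<and> z \<epsilon> R \<longrightarrow> x \<oplus> y \<oplus> z = x \<oplus> (y \<oplus> z)"
  "\<forall>x y. x \<epsilon> R \<and> y \<epsilon> R \<longrightarrow> x \<oplus> y = y \<oplus> x"
  "\<forall>x. x \<epsilon> R \<longrightarrow> x \<oplus> zr = x" "\<forall>x. x \<epsilon> R \<longrightarrow> (\<exists>y. y \<epsilon> R \<and> x \<oplus> y = zr)"
  "one \<epsilon> R \<and> one \<noteq> zr" "\<forall>x. x \<epsilon> R \<and> x \<noteq> zr \<longrightarrow> x \<odot> one = x"
  "\<forall>x. x \<epsilon> R \<and> x \<noteq> zr \<longrightarrow> (\<exists>y. (y \<epsilon> R \<and> y \<noteq> zr) \<and> x \<odot> y = one)"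
  "\<forall>x y. x \<epsilon> R \<and> y \<epsilon> R \<longrightarrow> x \<odot> y = y \<odot> x"
  "\<forall>x y z. x \<epsilon> R \<and> y \<epsilon> R \<and> z \<epsilon> R \<longrightarrow> x \<odot> (y \<oplus> z) = x \<odot> y \<oplus> x \<odot> z"
  "\<forall>x. x \<epsilon> R \<longrightarrow> \<not> x \<prec> x" "\<forall>x y z. x \<prec> y \<and> y \<prec> z \<longrightarrow> x \<prec> z"
  "\<forall>x y. x \<epsilon> R \<and> y \<epsilon> R \<longrightarrow> x \<prec> y \<or> x = y \<or> y \<prec> x"
  "\<forall>x y z. x \<prec> y \<and> z \<epsilon> R \<longrightarrow> x \<oplus> z \<prec> y \<oplus> z"
  "\<forall>x y. zr \<prec> x \<and> zr \<prec> y \<longrightarrow> zr \<prec> x \<odot> y"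
  "\<forall>A. subset_of mem A R \<and> (\<exists>x. x \<epsilon> A) \<and> (\<exists>u. upper_bound mem R lt A u) \<longrightarrow>
    (\<exists>u. upper_bound mem R lt A u \<and> (\<forall>v. upper_bound mem R lt A v \<longrightarrow> u \<preceq> v))"
  using field[unfolded complete_ordered_field_def abelian_group_def nonzero_iff]
  by - (elim conjE, (intro conjI)?; assumption)+

lemma less_R: "x \<prec> y \<Longrightarrow> x \<epsilon> R" "x \<prec> y \<Longrightarrow> y \<epsilon> R"
  using field_axioms(2) unfolding subset_of_def less_in_def in_cart by fastforce+

lemma less_R_irrefl: "\<not> x \<prec> x"
  using field_axioms(14) less_R(1) by blast

lemma less_R_trans: "x \<prec> y \<Longrightarrow> y \<prec> z \<Longrightarrow> x \<prec> z"
  using field_axioms(15) by blast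

lemma less_R_linear: "x \<epsilon> R \<Longrightarrow> y \<epsilon> R \<Longrightarrow> x \<prec> y \<or> x = y \<or> y \<prec> x"
  using field_axioms(16) by blast

lemma zero_R: "zr \<epsilon> R" by (rule field_axioms(3))

lemma add_closed: "x \<epsilon> R \<Longrightarrow> y \<epsilon> R \<Longrightarrow> x \<oplus> y \<epsilon> R"
  using field_axioms(4) by blast

lemma add_assoc: "x \<epsilon> R \<Longrightarrow> y \<epsilon> R \<Longrightarrow> z \<epsilon> R \<Longrightarrow> x \<oplus> y \<oplus> z = x \<oplus> (y \<oplus> z)"
  using field_axioms(5) by blast

lemma add_comm: "x \<epsilon> R \<Longrightarrow> y \<epsilon> R \<Longrightarrow> x \<oplus> y = y \<oplus> x"
  using field_axioms(6) by blast

lemma add_zero: "x \<epsilon> R \<Longrightarrow> x \<oplus> zr = x"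
  using field_axioms(7) by blast

lemma ex_neg: "x \<epsilon> R \<Longrightarrow> \<exists>y. y \<epsilon> R \<and> x \<oplus> y = zr"
  using field_axioms(8) by blast

lemma one_R: "one \<epsilon> R" and one_neq_zero: "one \<noteq> zr"
  using field_axioms(9) by blast+

lemma mult_one: "x \<epsilon> R \<Longrightarrow> x \<noteq> zr \<Longrightarrow> x \<odot> one = x"
  using field_axioms(10) by blast

lemma ex_inverse: "x \<epsilon> R \<Longrightarrow> x \<noteq> zr \<Longrightarrow> \<exists>y. y \<epsilon> R \<and> y \<noteq> zr \<and> x \<odot> y = one"
  using field_axioms(11) by blast

lemma mult_comm: "x \<epsilon> R \<Longrightarrow> y \<epsilon> R \<Longrightarrow> x \<odot> y = y \<odot> x"
  using field_axioms(12) by blast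

lemma distrib: "x \<epsilon> R \<Longrightarrow> y \<epsilon> R \<Longrightarrow> z \<epsilon> R \<Longrightarrow> x \<odot> (y \<oplus> z) = x \<odot> y \<oplus> x \<odot> z"
  using field_axioms(13) by blast

lemma add_less_mono: "x \<prec> y \<Longrightarrow> z \<epsilon> R \<Longrightarrow> x \<oplus> z \<prec> y \<oplus> z"
  using field_axioms(17) by blast

lemma mult_pos: "zr \<prec> x \<Longrightarrow> zr \<prec> y \<Longrightarrow> zr \<prec> x \<odot> y"
  using field_axioms(18) by blast

lemma mult_closed: "x \<epsilon> R \<Longrightarrow> y \<epsilon> R \<Longrightarrow> x \<odot> y \<epsilon> R"
  using mapsD(2)[OF field_axioms(1), of "\<langle>x, y\<rangle>"] by (auto simp: in_cart op2_def)

lemma ex_sup: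
  assumes "dP (\<lambda>e. P (e 0))" "x \<epsilon> R" "P x" "b \<epsilon> R" "\<And>x. P x \<Longrightarrow> x \<epsilon> R \<Longrightarrow> x \<preceq> b"
  shows "\<exists>u. u \<epsilon> R \<and> (\<forall>x. x \<epsilon> R \<and> P x \<longrightarrow> x \<preceq> u) \<and>
    (\<forall>v. v \<epsilon> R \<and> (\<forall>x. x \<epsilon> R \<and> P x \<longrightarrow> x \<preceq> v) \<longrightarrow> u \<preceq> v)"
proof -
  obtain A where A: "\<And>x. x \<epsilon> A \<longleftrightarrow> x \<epsilon> R \<and> P x" using ex_separation[OF assms(1)] by metis
  have *: "upper_bound mem R lt A u \<longleftrightarrow> u \<epsilon> R \<and> (\<forall>x. x \<epsilon> R \<and> P x \<longrightarrow> x \<preceq> u)" for u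
    unfolding upper_bound_def A by blast
  show ?thesis
    using field_axioms(19)[rule_format, of A] unfolding * subset_of_def A using assms(2-5) by blast
qed

lemma dP_less: "dT t \<Longrightarrow> dT u \<Longrightarrow> dP (\<lambda>e. t e \<prec> u e)"
  unfolding less_in_def by (intro dfn dT_pair)

lemma dP_leq: "dT t \<Longrightarrow> dT u \<Longrightarrow> dP (\<lambda>e. t e \<preceq> u e)"
  unfolding leq_in_def by (intro dfn dP_less)

lemma dT_op2: "dT t \<Longrightarrow> dT u \<Longrightarrow> dT (\<lambda>e. op2 mem f (t e) (u e))"
  unfolding op2_def by (intro dfn dT_pair dT_app)

lemma ex_diff:
  assumes "x \<epsilon> R" "y \<epsilon> R" shows "\<exists>d. d \<epsilon> R \<and> x \<oplus> d = y \<and> (x \<prec> y \<longrightarrow> zr \<prec> d)"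
proof -
  obtain n where n: "n \<epsilon> R" "x \<oplus> n = zr" using ex_neg assms by blast
  have "x \<oplus> (y \<oplus> n) = y"
    using assms n add_assoc[of x y n] add_comm[of x y] add_assoc[of y x n] add_zero by simp
  moreover have "x \<prec> y \<Longrightarrow> zr \<prec> y \<oplus> n" using add_less_mono[of x y n] n by simp
  ultimately show ?thesis using add_closed assms n by blast
qed

lemma less_add: "zr \<prec> d \<Longrightarrow> x \<epsilon> R \<Longrightarrow> x \<prec> x \<oplus> d"
  using add_less_mono[of zr d x] add_comm[of x] add_zero[of x] less_R(2) zero_R by metis

text \<open>If 1 were negative, n = -1 would be positive, making n + n * n positive; but it equals n
  * (1 + n) = 0.\<close>

lemma zero_less_one: "zr \<prec> one"
proof -
  have False if lt: "one \<prec> zr"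
  proof -
    obtain n where n: "n \<epsilon> R" "one \<oplus> n = zr" using ex_neg one_R by blast
    have "zr \<prec> n"
      using add_less_mono[OF lt n(1)] n add_comm[OF zero_R n(1)] add_zero[OF n(1)] by simp
    then have nz: "n \<noteq> zr" "zr \<prec> n \<odot> n" using less_R_irrefl mult_pos by auto
    \<comment> \<open>n * 0 = 0 has to be derived from distributivity by cancelling, as the
      multiplicative group contains only nonzero elements.\<close>
    have "n \<odot> zr \<oplus> n \<odot> zr = n \<odot> zr"
      using distrib[OF n(1) zero_R zero_R] add_zero[OF zero_R] by simp
    moreover obtain k where "k \<epsilon> R" "n \<odot> zr \<oplus> k = zr"
      using ex_neg mult_closed n zero_R by blast
    ultimately have "n \<odot> zr = zr"
      using add_assoc[of "n \<odot> zr" "n \<odot> zr" k] mult_closed[OF n(1) zero_R] add_zero by simp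
    then have "n \<oplus> n \<odot> n = zr"
      using distrib[OF n(1) one_R n(1)] n mult_one[OF n(1) nz(1)] by simp
    moreover have "zr \<prec> n \<oplus> n \<odot> n"
      using less_add[OF nz(2) n(1)] \<open>zr \<prec> n\<close> less_R_trans by blast
    ultimately show False using less_R_irrefl by simp
  qed
  then show ?thesis using less_R_linear[OF zero_R one_R] one_neq_zero by blast
qed

text \<open>\<open>h\<close> is the inverse of 1 + 1; if it were negative, so would be h + h = 1. It
  halves the step size in \<open>ex_dense\<close>.\<close>

lemma ex_half: "\<exists>h. h \<epsilon> R \<and> (\<forall>d. zr \<prec> d \<longrightarrow> zr \<prec> d \<odot> h \<and> d \<odot> h \<oplus> d \<odot> h = d)"
proof -
  have "zr \<prec> one \<oplus> one" using less_add zero_less_one one_R less_R_trans by blast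
  then have "one \<oplus> one \<noteq> zr" using less_R_irrefl by auto
  then obtain h where h: "h \<epsilon> R" "h \<noteq> zr" "(one \<oplus> one) \<odot> h = one"
    using ex_inverse add_closed one_R by blast
  have hh: "h \<oplus> h = one"
    using h distrib[OF h(1) one_R one_R] mult_one[OF h(1,2)] mult_comm[OF h(1) add_closed[OF one_R one_R]]
    by simp
  have "\<not> h \<prec> zr"
  proof
    assume "h \<prec> zr"
    then have "h \<oplus> h \<prec> zr"
      using add_less_mono[of h zr h] h add_comm[OF zero_R h(1)] add_zero[OF h(1)] less_R_trans by metis
    then show False using hh zero_less_one less_R_trans less_R_irrefl by metis
  qed
  then have "zr \<prec> h" using h less_R_linear zero_R by blast
  moreover have "d \<odot> h \<oplus> d \<odot> h = d" if "zr \<prec> d" for d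
    using distrib[OF less_R(2)[OF that] h(1,1)] hh mult_one[OF less_R(2)[OF that]] that less_R_irrefl
    by auto
  ultimately show ?thesis using h mult_pos by blast
qed

lemma leq_less: "x \<preceq> y \<Longrightarrow> y \<prec> z \<Longrightarrow> x \<prec> z" and less_leq: "x \<prec> y \<Longrightarrow> y \<preceq> z \<Longrightarrow> x \<prec> z"
  and leq_trans: "x \<preceq> y \<Longrightarrow> y \<preceq> z \<Longrightarrow> x \<preceq> z"
  using less_R_trans unfolding leq_in_def by blast+

lemma not_less: "x \<epsilon> R \<Longrightarrow> y \<epsilon> R \<Longrightarrow> \<not> x \<prec> y \<longleftrightarrow> y \<preceq> x"
  using less_R_linear less_R_trans less_R_irrefl unfolding leq_in_def by blast

lemma not_leq: "x \<epsilon> R \<Longrightarrow> y \<epsilon> R \<Longrightarrow> \<not> x \<preceq> y \<longleftrightarrow> y \<prec> x"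
  using less_R_linear less_R_trans less_R_irrefl unfolding leq_in_def by blast

text \<open>
  The sequence walks from \<open>a0\<close> upwards in steps of size \<open>\<delta>\<close> until it exceeds \<open>b0\<close>, then restarts
  at \<open>a0\<close> with step size \<open>\<delta>/2\<close>; it moves only at odd times, so that every position is visited at
  an odd time.
\<close>

lemma ex_dense:
  assumes "a0 \<prec> b0"
  shows "\<exists>q. maps mem q \<omega> R \<and> (\<forall>x y. a0 \<preceq> x \<and> x \<prec> y \<and> y \<preceq> b0 \<longrightarrow>
     (\<exists>m. m \<epsilon> \<omega> \<and> ev m \<and> x \<prec> q \<cdot> \<ss> m \<and> q \<cdot> \<ss> m \<prec> y))"
proof -
  note ab = less_R[OF assms]
  obtain hf where hf: "hf \<epsilon> R" "\<And>d. zr \<prec> d \<Longrightarrow> zr \<prec> d \<odot> hf \<and> d \<odot> hf \<oplus> d \<odot> hf = d"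
    using ex_half by blast
  \<comment> \<open>States are pairs of a step size and a position.\<close>
  define step where "step x = (if psnd x \<preceq> b0 then \<langle>pfst x, psnd x \<oplus> pfst x\<rangle>
    else \<langle>pfst x \<odot> hf, a0\<rangle>)" for x
  have "\<exists>h. maps mem h \<omega> (cart mem R R) \<and> h \<cdot> \<zero> = \<langle>one, a0\<rangle> \<and>
    (\<forall>n. n \<epsilon> \<omega> \<longrightarrow> h \<cdot> \<ss> n = (\<lambda>n x. if ev n then x else step x) n (h \<cdot> n))"
    by (rule ex_iteration, unfold step_def,
        intro dfn dP_ev dP_leq dT_pair dT_op2 dT_pfst dT_psnd)
      (use ab hf(1) one_R add_closed mult_closed in \<open>auto simp: in_cart\<close>)
  then obtain h where h: "maps mem h \<omega> (cart mem R R)" "h \<cdot> \<zero> = \<langle>one, a0\<rangle>"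
    "\<And>n. n \<epsilon> \<omega> \<Longrightarrow> h \<cdot> \<ss> n = (if ev n then h \<cdot> n else step (h \<cdot> n))" by auto
  define H where "H d e \<longleftrightarrow> (\<exists>m. m \<epsilon> \<omega> \<and> ev m \<and> h \<cdot> \<ss> m = \<langle>d, e\<rangle>)" for d e
  have dH: "dP (\<lambda>e. H (t e) (u e))" if "dT t" "dT u" for t u
    by (rule dP_subst2[of H, OF _ that]) (unfold H_def, intro dfn dP_ev dT_app dT_succ dT_pair)
  have HR: "d \<epsilon> R \<and> e \<epsilon> R" if de: "H d e" for d e
  proof -
    obtain m where "m \<epsilon> \<omega>" "h \<cdot> \<ss> m = \<langle>d, e\<rangle>" using de unfolding H_def by blast
    then have "\<langle>d, e\<rangle> \<epsilon> cart mem R R" using mapsD(2)[OF h(1), of "\<ss> m"] by simp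
    then show ?thesis by (auto simp: in_cart)
  qed
  have H0: "H one a0" unfolding H_def using h by (intro exI[of _ \<zero>]) simp
  \<comment> \<open>One move takes two units of time: the step is made at an odd time, and its
    result is copied at the even time after it.\<close>
  have Hs: "H (pfst (step \<langle>d, e\<rangle>)) (psnd (step \<langle>d, e\<rangle>))" if de: "H d e" for d e
  proof -
    obtain m where m: "m \<epsilon> \<omega>" "ev m" "h \<cdot> \<ss> m = \<langle>d, e\<rangle>" using de unfolding H_def by blast
    then have "h \<cdot> \<ss> (\<ss> m) = step \<langle>d, e\<rangle>" "ev (\<ss> (\<ss> m))" using h(3)[of "\<ss> m"] by auto
    then have "h \<cdot> \<ss> (\<ss> (\<ss> m)) = step \<langle>d, e\<rangle>" using m h(3)[of "\<ss> (\<ss> m)"] by simp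
    then show ?thesis unfolding H_def using m \<open>ev (\<ss> (\<ss> m))\<close>
      by (intro exI[of _ "\<ss> (\<ss> m)"]) (simp add: step_def)
  qed
  have Hadd: "H d (e \<oplus> d)" if "H d e" "e \<preceq> b0" for d e
    using Hs[OF that(1)] that(2) by (simp add: step_def)
  have Hhalf: "H (d \<odot> hf) a0" if "H d e" "b0 \<prec> e" for d e
    using Hs[OF that(1)] not_leq[of e b0] HR[OF that(1)] ab that(2) by (simp add: step_def)
  \<comment> \<open>Archimedean argument: let \<open>u\<close> be the supremum of the positions up
    to \<open>x\<close> visited with step \<open>d\<close>. One of them, \<open>e\<close>, lies
    above u - d; then e + d > u, so e + d exceeds \<open>x\<close>.\<close>
  have reach: "\<exists>e. H d e \<and> x \<prec> e \<and> e \<preceq> x \<oplus> d"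
    if d: "H d a0" "zr \<prec> d" and x: "x \<epsilon> R" "a0 \<preceq> x" "x \<preceq> b0" for d x
  proof -
    have "\<exists>u. u \<epsilon> R \<and> (\<forall>e. e \<epsilon> R \<and> (H d e \<and> e \<preceq> x) \<longrightarrow> e \<preceq> u) \<and>
      (\<forall>v. v \<epsilon> R \<and> (\<forall>e. e \<epsilon> R \<and> (H d e \<and> e \<preceq> x) \<longrightarrow> e \<preceq> v) \<longrightarrow> u \<preceq> v)"
      by (rule ex_sup[of _ a0 x], intro dfn dH dP_leq) (use ab d x in auto)
    then obtain u where u: "u \<epsilon> R" "\<And>e. H d e \<Longrightarrow> e \<preceq> x \<Longrightarrow> e \<preceq> u"
      "\<And>v. v \<epsilon> R \<Longrightarrow> (\<And>e. H d e \<Longrightarrow> e \<preceq> x \<Longrightarrow> e \<preceq> v) \<Longrightarrow> u \<preceq> v"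
      using HR by metis
    have dR: "d \<epsilon> R" using d(2) less_R by blast
    obtain w where w: "w \<epsilon> R" "d \<oplus> w = u" using ex_diff[OF dR u(1)] by blast
    then have w': "w \<oplus> d = u" using add_comm[OF dR w(1)] by simp
    then have "w \<prec> u" using less_add[OF d(2) w(1)] by simp
    then obtain e where e: "H d e" "e \<preceq> x" "\<not> e \<preceq> w"
      using u(3)[OF w(1)] not_leq[OF u(1) w(1)] by blast
    then have "w \<prec> e" using not_leq HR w by blast
    then have lt: "u \<prec> e \<oplus> d" using add_less_mono[of w e d] dR w' by simp
    have He: "H d (e \<oplus> d)" using Hadd e leq_trans x by blast
    have "x \<prec> e \<oplus> d"
      using u(2)[OF He] lt not_leq[of "e \<oplus> d" x] not_leq[of "e \<oplus> d" u] HR[OF He] u(1) x(1) by blast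
    moreover have "e \<oplus> d \<preceq> x \<oplus> d" using e(2) add_less_mono dR unfolding leq_in_def by blast
    ultimately show ?thesis using He by blast
  qed
  have halve: "H (d \<odot> hf) a0" if "H d a0" "zr \<prec> d" for d
    using reach[OF that ab(2)] Hhalf assms unfolding leq_in_def by blast
  have small: "\<exists>d. H d a0 \<and> zr \<prec> d \<and> d \<prec> r" if r: "zr \<prec> r" for r
  proof (rule ccontr)
    assume "\<not> ?thesis"
    then have low: "r \<preceq> d" if "H d a0" "zr \<prec> d" for d
      using that less_R[OF r] less_R[OF that(2)] not_less by blast
    \<comment> \<open>The infimum \<open>u\<close> of the step sizes is obtained as the supremum of
      their lower bounds. As each step size is twice another one, 2u is again a lower bound, which
      contradicts u > 0.\<close>
    define P where "P l \<longleftrightarrow> (\<forall>d. H d a0 \<and> zr \<prec> d \<longrightarrow> l \<preceq> d)" for l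
    have "\<exists>u. u \<epsilon> R \<and> (\<forall>l. l \<epsilon> R \<and> P l \<longrightarrow> l \<preceq> u) \<and>
      (\<forall>v. v \<epsilon> R \<and> (\<forall>l. l \<epsilon> R \<and> P l \<longrightarrow> l \<preceq> v) \<longrightarrow> u \<preceq> v)"
    proof (rule ex_sup)
      show "dP (\<lambda>e. P (e 0))" unfolding P_def by (intro dfn dH dP_less dP_leq)
      show "r \<epsilon> R" "P r" using low less_R(2)[OF r] by (auto simp: P_def)
      show "x \<preceq> one" if "P x" for x using that H0 zero_less_one by (auto simp: P_def)
    qed (rule one_R)
    then obtain u where u: "u \<epsilon> R" "\<And>l. l \<epsilon> R \<Longrightarrow> P l \<Longrightarrow> l \<preceq> u"
      "\<And>v. v \<epsilon> R \<Longrightarrow> (\<And>l. l \<epsilon> R \<Longrightarrow> P l \<Longrightarrow> l \<preceq> v) \<Longrightarrow> u \<preceq> v" by blast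
    have "r \<preceq> u" using u(2) low less_R(2)[OF r] by (simp add: P_def)
    then have u0: "zr \<prec> u" using r less_leq by blast
    have "P (u \<oplus> u)" unfolding P_def
    proof (intro allI impI, elim conjE)
      fix d assume d: "H d a0" "zr \<prec> d"
      define k where "k = d \<odot> hf"
      have k: "H k a0" "zr \<prec> k" "k \<oplus> k = d" using halve[OF d] hf(2)[OF d(2)] unfolding k_def by auto
      have kR: "k \<epsilon> R" using k less_R by blast
      have le: "u \<preceq> k" using u(3)[OF kR] k by (auto simp: P_def)
      have "u \<oplus> u \<preceq> k \<oplus> k"
      proof (cases "u = k")
        case False
        then have "u \<prec> k" using le unfolding leq_in_def by blast
        then have "u \<oplus> u \<prec> k \<oplus> u" "u \<oplus> k \<prec> k \<oplus> k" using add_less_mono u(1) kR by blast+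
        then show ?thesis using add_comm[OF u(1) kR] less_R_trans unfolding leq_in_def by metis
      qed (simp add: leq_in_def)
      then show "u \<oplus> u \<preceq> d" using k by simp
    qed
    then have "u \<oplus> u \<preceq> u" using u add_closed by blast
    then show False using less_add[OF u0 u(1)] not_leq add_closed u(1) by blast
  qed
  have "\<exists>q. maps mem q \<omega> R \<and> (\<forall>n. n \<epsilon> \<omega> \<longrightarrow> q \<cdot> n = psnd (h \<cdot> n))"
  proof (rule ex_lam)
    show "dP (\<lambda>e. e (Suc 0) = psnd (h \<cdot> e 0))" by (intro dfn dT_psnd dT_app)
    show "psnd (h \<cdot> n) \<epsilon> R" if "n \<epsilon> \<omega>" for n
      using mapsD(2)[OF h(1) that] by (auto simp: in_cart)
  qed
  then obtain q where q: "maps mem q \<omega> R" "\<And>n. n \<epsilon> \<omega> \<Longrightarrow> q \<cdot> n = psnd (h \<cdot> n)" by blast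
  have "\<exists>m. m \<epsilon> \<omega> \<and> ev m \<and> x \<prec> q \<cdot> \<ss> m \<and> q \<cdot> \<ss> m \<prec> y"
    if le: "a0 \<preceq> x" "x \<prec> y" "y \<preceq> b0" for x y
  proof -
    note xy = less_R[OF le(2)]
    obtain r where r: "x \<oplus> r = y" "zr \<prec> r" using ex_diff[OF xy] le(2) by blast
    obtain d where d: "H d a0" "zr \<prec> d" "d \<prec> r" using small r by blast
    obtain e where e: "H d e" "x \<prec> e" "e \<preceq> x \<oplus> d"
      using reach[OF d(1,2) xy(1) le(1)] le(2,3) less_leq unfolding leq_in_def by blast
    have "x \<oplus> d \<prec> y"
      using add_less_mono[OF d(3) xy(1)] r(1) add_comm[OF xy(1)] less_R[OF d(3)] by metis
    then have "e \<prec> y" using e(3) leq_less by blast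
    then show ?thesis using e(1,2) q(2) unfolding H_def by (metis succ_omega psnd_pair)
  qed
  then show ?thesis using q(1) by blast
qed

end

section \<open>The game on cuts\<close>

locale cut_game = zf_reals mem R add mul lt zr one
  for mem :: "'v \<Rightarrow> 'v \<Rightarrow> bool"  (infix "\<epsilon>" 50) and R add mul lt zr one :: 'v +
  fixes a0 b0 S q :: 'v
  assumes ab: "a0 \<prec> b0"
    and S: "x \<epsilon> S \<Longrightarrow> x \<epsilon> R \<and> a0 \<preceq> x \<and> x \<preceq> b0"
    and q: "maps mem q \<omega> R"
    and dense: "a0 \<preceq> x \<Longrightarrow> x \<prec> y \<Longrightarrow> y \<preceq> b0 \<Longrightarrow>
      \<exists>m. m \<epsilon> \<omega> \<and> ev m \<and> x \<prec> q \<cdot> \<ss> m \<and> q \<cdot> \<ss> m \<prec> y"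
begin

text \<open>
  A real \<open>x\<close> is identified with its cut, that is with the function \<open>bit x\<close>.  At the even time \<open>m\<close>
  the first player either prescribes, by playing 0 or 1, the reply of the second player at
  time \<open>m + 1\<close>, or leaves it open by playing any other number; nonzero replies
  stand for the bit 1.
\<close>

definition bit :: "'v \<Rightarrow> 'v \<Rightarrow> 'v" where
  "bit x n = (if q \<cdot> n \<prec> x then \<one> else \<zero>)"

text \<open>It is the second player who can break this rule, and \<open>payoff\<close> then awards
  the play to the first.\<close>

definition legal :: "'v \<Rightarrow> bool" where
  "legal z \<longleftrightarrow> (\<forall>m. m \<epsilon> \<omega> \<and> ev m \<longrightarrow>
     (z \<cdot> m = \<zero> \<longrightarrow> z \<cdot> \<ss> m = \<zero>) \<and> (z \<cdot> m = \<one> \<longrightarrow> z \<cdot> \<ss> m \<noteq> \<zero>))"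

text \<open>Replies fall on odd times, so only the points \<open>q \<cdot> n\<close> with odd
  \<open>n\<close> are tested; by the assumption \<open>dense\<close> these alone are dense.\<close>

definition matches :: "'v \<Rightarrow> 'v \<Rightarrow> bool" where
  "matches z x \<longleftrightarrow> (\<forall>m. m \<epsilon> \<omega> \<and> ev m \<longrightarrow> (z \<cdot> \<ss> m = \<zero> \<longleftrightarrow> bit x (\<ss> m) = \<zero>))"

definition inf_open :: "'v \<Rightarrow> bool" where
  "inf_open z \<longleftrightarrow> (\<forall>N. N \<epsilon> \<omega> \<longrightarrow>
     (\<exists>m. m \<epsilon> \<omega> \<and> ev m \<and> \<not> m \<epsilon> N \<and> z \<cdot> m \<noteq> \<zero> \<and> z \<cdot> m \<noteq> \<one>))"

definition payoff :: "'v \<Rightarrow> bool" where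
  "payoff z \<longleftrightarrow> maps mem z \<omega> \<omega> \<and>
     (\<not> legal z \<or> ((\<exists>x. x \<epsilon> S \<and> matches z x) \<and> inf_open z))"

lemma dT_bit: "dT t \<Longrightarrow> dT u \<Longrightarrow> dT (\<lambda>e. bit (t e) (u e))"
  by (rule dT_fun2) (unfold bit_def, intro dfn dT_app dP_less)

lemma dP_matches: "dT t \<Longrightarrow> dT u \<Longrightarrow> dP (\<lambda>e. matches (t e) (u e))"
  by (rule dP_subst2[of matches]) (unfold matches_def, intro dfn dT_app dT_succ dT_bit dP_ev)

lemma dP_legal: "dT t \<Longrightarrow> dP (\<lambda>e. legal (t e))"
  by (rule dP_subst1[of legal]) (unfold legal_def, intro dfn dT_app dT_succ dP_ev)

lemma dP_payoff: "dP (\<lambda>e. payoff (e 0))"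
  unfolding payoff_def inf_open_def
  by (intro dfn dT_app dT_succ dT_bit dP_ev dP_maps dP_matches dP_legal)

lemma bit_cases: "bit x n = \<zero> \<or> bit x n = \<one>"
  by (simp add: bit_def)

lemma bit_omega: "bit x n \<epsilon> \<omega>"
  by (simp add: bit_def del: in_succ)

lemma bit_neq_zero: "bit x n \<noteq> \<zero> \<longleftrightarrow> q \<cdot> n \<prec> x" and bit_eq_one: "bit x n = \<one> \<longleftrightarrow> q \<cdot> n \<prec> x"
  by (simp_all add: bit_def)

lemma bit_eq_iff: "bit x n = bit y k \<longleftrightarrow> (bit x n = \<zero> \<longleftrightarrow> bit y k = \<zero>)"
  by (simp add: bit_def)

text \<open>Between two distinct reals of the interval lies a point of \<open>q\<close> with odd
  index, and it belongs to just one of the cuts.\<close>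

lemma eq_by_bits:
  assumes "x \<epsilon> R" "a0 \<preceq> x" "x \<preceq> b0" "y \<epsilon> R" "a0 \<preceq> y" "y \<preceq> b0"
    and "\<And>m. m \<epsilon> \<omega> \<Longrightarrow> ev m \<Longrightarrow> bit x (\<ss> m) = bit y (\<ss> m)"
  shows "x = y"
proof -
  have "\<not> x \<prec> y" if le: "a0 \<preceq> x" "y \<preceq> b0" and
    bits: "\<And>m. m \<epsilon> \<omega> \<Longrightarrow> ev m \<Longrightarrow> bit x (\<ss> m) = bit y (\<ss> m)" for x y
  proof
    assume "x \<prec> y"
    then obtain m where "m \<epsilon> \<omega>" "ev m" "x \<prec> q \<cdot> \<ss> m" "q \<cdot> \<ss> m \<prec> y" using dense le by blast
    then show False using bits bit_eq_one less_R_trans less_R_irrefl by metis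
  qed
  from this[of x y] this[of y x] show ?thesis using assms less_R_linear by metis
qed

text \<open>
  Against a winning strategy of the second player, the first player leaves the reply open exactly
  when it will be correct for \<open>x\<close>.  All replies are then correct, so this happens only finitely
  often; after that the strategy predicts the bits of \<open>x\<close>, by being wrong on all of them.
\<close>

lemma countable_if_wins_second:
  assumes t: "maps mem t (finseqs mem \<omega>) \<omega>"
    and win: "\<And>z. maps mem z \<omega> \<omega> \<Longrightarrow>
      (\<And>n. n \<epsilon> \<omega> \<Longrightarrow> \<not> ev n \<Longrightarrow> z \<cdot> n = t \<cdot> (z \<restriction> n)) \<Longrightarrow> \<not> payoff z"
  shows "countable_set mem S"
proof -
  \<comment> \<open>\<open>t \<cdot> snoc s n \<two>\<close> is the reply that the open move 2 would
    receive, looked up before the move is made.\<close>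
  define G where "G x n s = (if ev n then
      (if (t \<cdot> snoc s n \<two> = \<zero>) = (bit x (\<ss> n) = \<zero>) then \<two> else bit x (\<ss> n))
    else t \<cdot> s)" for x n s
  \<comment> \<open>\<open>d\<close> keeps only the first player's moves, which are digits; the
    replies can be arbitrary numbers, but are recovered from \<open>t\<close>.\<close>
  define Rl where "Rl x d N \<longleftrightarrow> x \<epsilon> S \<and> N \<epsilon> \<omega> \<and> (\<exists>z. maps mem z \<omega> \<omega> \<and>
    (\<forall>n. n \<epsilon> \<omega> \<longrightarrow> z \<cdot> n = G x n (z \<restriction> n)) \<and> matches z x \<and>
    (\<forall>m. m \<epsilon> \<omega> \<and> ev m \<and> \<not> m \<epsilon> N \<longrightarrow> z \<cdot> m = \<zero> \<or> z \<cdot> m = \<one>) \<and>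
    (\<forall>n. n \<epsilon> \<omega> \<longrightarrow> d \<cdot> n = (if ev n then z \<cdot> n else \<zero>)))" for x d N
  have two: "\<two> \<epsilon> \<omega>" using succ_omega zero_omega by metis
  show ?thesis
  proof (rule countable_by_digits[of Rl])
    show "dP (\<lambda>e. Rl (e 0) (e (Suc 0)) (e (Suc (Suc 0))))"
      unfolding Rl_def G_def
      by (intro dfn dP_ev dT_app dT_snoc dT_succ dT_bit dT_restr dP_maps dP_matches)
  next
    fix x d N assume Rl: "Rl x d N"
    have "digit (G x n s)" if "ev n" for n s
      using that bit_cases[of x "\<ss> n"] by (auto simp: G_def digit_def)
    then have "digit (d \<cdot> n)" if "n \<epsilon> \<omega>" for n
      using Rl that unfolding Rl_def by (auto simp: digit_def[of \<zero>])
    then show "N \<epsilon> \<omega> \<and> (\<forall>k. k \<epsilon> \<omega> \<longrightarrow> digit (d \<cdot> k))" using Rl unfolding Rl_def by blast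
  next
    fix x assume x: "x \<epsilon> S"
    have "\<exists>z. maps mem z \<omega> \<omega> \<and> (\<forall>n. n \<epsilon> \<omega> \<longrightarrow> z \<cdot> n = G x n (z \<restriction> n))"
    proof (rule ex_recursion)
      show "dP (\<lambda>e. e (Suc (Suc 0)) = G x (e 0) (e (Suc 0)))"
        unfolding G_def by (intro dfn dP_ev dT_app dT_snoc dT_succ dT_bit)
      show "G x n s \<epsilon> \<omega>" if "n \<epsilon> \<omega>" "maps mem s n \<omega>" for n s
        using that two bit_omega mapsD(2)[OF t, of s] in_finseqs by (auto simp: G_def simp del: in_succ)
    qed
    then obtain z where z: "maps mem z \<omega> \<omega>" "\<And>n. n \<epsilon> \<omega> \<Longrightarrow> z \<cdot> n = G x n (z \<restriction> n)" by blast
    have nw: "\<not> payoff z" by (rule win[OF z(1)]) (simp add: z(2) G_def)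
    then have "legal z" using z(1) unfolding payoff_def by blast
    have match: "matches z x" unfolding matches_def
    proof (intro allI impI, elim conjE)
      fix m assume m: "m \<epsilon> \<omega>" "ev m"
      have "z \<cdot> \<ss> m = t \<cdot> snoc (z \<restriction> m) m (z \<cdot> m)"
        using z(2)[of "\<ss> m"] m restr_succ[OF z(1) m(1)] by (simp add: G_def)
      moreover have "z \<cdot> m = G x m (z \<restriction> m)" using z(2) m by blast
      moreover have "bit x (\<ss> m) = \<zero> \<or> bit x (\<ss> m) = \<one>" by (rule bit_cases)
      ultimately show "z \<cdot> \<ss> m = \<zero> \<longleftrightarrow> bit x (\<ss> m) = \<zero>"
        using \<open>legal z\<close> m unfolding legal_def G_def by (auto split: if_splits)
    qed
    then have "\<not> inf_open z" using nw x z(1) unfolding payoff_def by blast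
    then obtain N where N: "N \<epsilon> \<omega>"
      "\<And>m. m \<epsilon> \<omega> \<Longrightarrow> ev m \<Longrightarrow> \<not> m \<epsilon> N \<Longrightarrow> z \<cdot> m = \<zero> \<or> z \<cdot> m = \<one>"
      unfolding inf_open_def by blast
    have "\<exists>d. maps mem d \<omega> \<omega> \<and> (\<forall>n. n \<epsilon> \<omega> \<longrightarrow> d \<cdot> n = (if ev n then z \<cdot> n else \<zero>))"
      by (rule ex_lam, intro dfn dP_ev dT_app) (use mapsD(2)[OF z(1)] in simp)
    then show "\<exists>d N. Rl x d N" unfolding Rl_def using x N z match by blast
  next
    fix x y d e N
    assume "Rl x d N" "Rl y e N" and de: "\<And>k. k \<epsilon> N \<Longrightarrow> d \<cdot> k = e \<cdot> k"
    obtain z where z: "x \<epsilon> S" "maps mem z \<omega> \<omega>" "\<And>n. n \<epsilon> \<omega> \<Longrightarrow> z \<cdot> n = G x n (z \<restriction> n)"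
      "matches z x" "\<And>m. m \<epsilon> \<omega> \<Longrightarrow> ev m \<Longrightarrow> \<not> m \<epsilon> N \<Longrightarrow> z \<cdot> m = \<zero> \<or> z \<cdot> m = \<one>"
      "\<And>n. n \<epsilon> \<omega> \<Longrightarrow> d \<cdot> n = (if ev n then z \<cdot> n else \<zero>)"
      using \<open>Rl x d N\<close> unfolding Rl_def by blast
    obtain w where w: "y \<epsilon> S" "maps mem w \<omega> \<omega>" "\<And>n. n \<epsilon> \<omega> \<Longrightarrow> w \<cdot> n = G y n (w \<restriction> n)"
      "matches w y" "\<And>m. m \<epsilon> \<omega> \<Longrightarrow> ev m \<Longrightarrow> \<not> m \<epsilon> N \<Longrightarrow> w \<cdot> m = \<zero> \<or> w \<cdot> m = \<one>"
      "\<And>n. n \<epsilon> \<omega> \<Longrightarrow> e \<cdot> n = (if ev n then w \<cdot> n else \<zero>)"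
      using \<open>Rl y e N\<close> unfolding Rl_def by blast
    have "z \<cdot> n = w \<cdot> n" if "n \<epsilon> \<omega>" for n
      using that
    proof (induction rule: omega_less_induct)
      case definable show ?case by (intro dfn dT_app)
    next
      case (less n)
      have eq: "z \<restriction> n = w \<restriction> n"
        using less omega_trans by (intro restr_eq[OF z(2) w(2)]) blast+
      consider "\<not> ev n" | "ev n" "n \<epsilon> N" | "ev n" "\<not> n \<epsilon> N" by blast
      then show ?case
      proof cases
        case 1 then show ?thesis using z(3) w(3) less eq by (simp add: G_def)
      next
        case 2 then show ?thesis using z(6) w(6) de less by metis
      next
        case 3
        \<comment> \<open>At equal positions \<open>t\<close> would reply to 2 in the same way, and
          both bits are opposite to this reply, hence equal.\<close>
        have "G x n (w \<restriction> n) \<noteq> \<two>" "G y n (w \<restriction> n) \<noteq> \<two>"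
          using z(3,5) w(3,5) less 3 eq by fastforce+
        then have "G x n (w \<restriction> n) = bit x (\<ss> n)" "G y n (w \<restriction> n) = bit y (\<ss> n)"
          "bit x (\<ss> n) = \<zero> \<longleftrightarrow> bit y (\<ss> n) = \<zero>" using 3 unfolding G_def by (auto split: if_splits)
        then show ?thesis using z(3) w(3) less eq bit_eq_iff[of x "\<ss> n" y "\<ss> n"] by simp
      qed
    qed
    then have "bit x (\<ss> m) = bit y (\<ss> m)" if "m \<epsilon> \<omega>" "ev m" for m
      using z(4) w(4) that succ_omega unfolding matches_def bit_eq_iff[of x] by metis
    then show "x = y" using eq_by_bits S z(1) w(1) by blast
  qed
qed

end

section \<open>A winning strategy of the first player\<close>

locale cut_game_won = cut_game mem R add mul lt zr one a0 b0 S q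
  for mem :: "'v \<Rightarrow> 'v \<Rightarrow> bool"  (infix "\<epsilon>" 50) and R add mul lt zr one a0 b0 S q :: 'v +
  fixes st :: 'v
  assumes st: "maps mem st (finseqs mem \<omega>) \<omega>"
    and win: "maps mem z \<omega> \<omega> \<Longrightarrow>
      (\<And>n. n \<epsilon> \<omega> \<Longrightarrow> ev n \<Longrightarrow> z \<cdot> n = st \<cdot> (z \<restriction> n)) \<Longrightarrow> payoff z"
begin

text \<open>The replies are the bits of \<open>x\<close> even where this breaks the rules;
  \<open>legal\<close> is imposed separately.\<close>

definition bit_play :: "'v \<Rightarrow> 'v \<Rightarrow> bool" where
  "bit_play x z \<longleftrightarrow> maps mem z \<omega> \<omega> \<and>
     (\<forall>n. n \<epsilon> \<omega> \<longrightarrow> z \<cdot> n = (if ev n then st \<cdot> (z \<restriction> n) else bit x n))"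

text \<open>The exception for the move 1 is forced by \<open>legal\<close>, which then asks for a
  nonzero reply.\<close>

definition zero_tail :: "'v \<Rightarrow> 'v \<Rightarrow> bool" where
  "zero_tail N z \<longleftrightarrow>
     (\<forall>m. m \<epsilon> \<omega> \<and> ev m \<and> \<not> \<ss> m \<epsilon> N \<and> z \<cdot> m \<noteq> \<one> \<longrightarrow> z \<cdot> \<ss> m = \<zero>)"

definition target :: "'v \<Rightarrow> bool" where
  "target x \<longleftrightarrow> x \<epsilon> S \<and> (\<exists>z N. bit_play x z \<and> legal z \<and> N \<epsilon> \<omega> \<and> zero_tail N z)"

lemma dP_bit_play: "dT t \<Longrightarrow> dT u \<Longrightarrow> dP (\<lambda>e. bit_play (t e) (u e))"
  by (rule dP_subst2[of bit_play])
    (unfold bit_play_def, intro dfn dP_maps dT_app dT_restr dT_bit dP_ev)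

lemma dP_zero_tail: "dT t \<Longrightarrow> dT u \<Longrightarrow> dP (\<lambda>e. zero_tail (t e) (u e))"
  by (rule dP_subst2[of zero_tail]) (unfold zero_tail_def, intro dfn dT_app dT_succ dP_ev)

lemma dP_target: "dT t \<Longrightarrow> dP (\<lambda>e. target (t e))"
  by (rule dP_subst1[of target])
    (unfold target_def, intro dfn dP_bit_play dP_zero_tail dP_legal)

lemma st_omega: "n \<epsilon> \<omega> \<Longrightarrow> maps mem s n \<omega> \<Longrightarrow> st \<cdot> s \<epsilon> \<omega>"
  using mapsD(2)[OF st] in_finseqs by blast

text \<open>Replies are restricted to 0 and 1 so that matching the cut of \<open>y\<close> makes
  them equal to its bits, not merely zero at the same places.\<close>

lemma legal_play:
  assumes z: "maps mem z \<omega> \<omega>" "\<And>n. n \<epsilon> \<omega> \<Longrightarrow> ev n \<Longrightarrow> z \<cdot> n = st \<cdot> (z \<restriction> n)"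
    "\<And>n. n \<epsilon> \<omega> \<Longrightarrow> \<not> ev n \<Longrightarrow> z \<cdot> n = \<zero> \<or> z \<cdot> n = \<one>" "legal z"
  shows "\<exists>y. y \<epsilon> S \<and> bit_play y z" "inf_open z"
proof -
  have "payoff z" using win z by blast
  then obtain y where y: "y \<epsilon> S" "matches z y" and "inf_open z"
    using z(4) unfolding payoff_def by blast
  then show "inf_open z" by blast
  have "z \<cdot> n = bit y n" if n: "n \<epsilon> \<omega>" "\<not> ev n" for n
  proof -
    obtain m where "m \<epsilon> \<omega>" "ev m" "n = \<ss> m" using odd_cases[OF n] by blast
    then show ?thesis using y(2) z(3)[OF n] bit_cases[of y n] unfolding matches_def by auto
  qed
  then show "\<exists>y. y \<epsilon> S \<and> bit_play y z" unfolding bit_play_def using y(1) z by auto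
qed

text \<open>The real that winning produces has the same bits at odd indices as \<open>x\<close>, so
  it is \<open>x\<close> itself.\<close>

lemma legal_bit_play:
  assumes "bit_play x z" "legal z" "x \<epsilon> R" "a0 \<preceq> x" "x \<preceq> b0"
  shows "x \<epsilon> S" "inf_open z"
proof -
  have z: "maps mem z \<omega> \<omega>" "\<And>n. n \<epsilon> \<omega> \<Longrightarrow> z \<cdot> n = (if ev n then st \<cdot> (z \<restriction> n) else bit x n)"
    using assms(1) unfolding bit_play_def by blast+
  have *: "z \<cdot> n = \<zero> \<or> z \<cdot> n = \<one>" if "n \<epsilon> \<omega>" "\<not> ev n" for n
    using that z(2) bit_cases by simp
  have **: "z \<cdot> n = st \<cdot> (z \<restriction> n)" if "n \<epsilon> \<omega>" "ev n" for n
    using that z(2) by simp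
  note lp = legal_play[OF z(1) ** * assms(2)]
  show "inf_open z" using lp(2) .
  obtain y where y: "y \<epsilon> S" "bit_play y z" using lp(1) by blast
  have "bit x (\<ss> m) = bit y (\<ss> m)" if "m \<epsilon> \<omega>" "ev m" for m
    using z(2)[of "\<ss> m"] y(2) that unfolding bit_play_def by simp
  then have "x = y" using eq_by_bits assms S y(1) by blast
  then show "x \<epsilon> S" using y by blast
qed

text \<open>\<open>st\<close> supplies the even moves, so a first difference between two plays can
  only be a reply.\<close>

lemma plays_agree:
  assumes "n \<epsilon> \<omega>" "maps mem z \<omega> \<omega>" "maps mem w \<omega> \<omega>"
    and "\<And>n. n \<epsilon> \<omega> \<Longrightarrow> ev n \<Longrightarrow> z \<cdot> n = st \<cdot> (z \<restriction> n)"
    and "\<And>n. n \<epsilon> \<omega> \<Longrightarrow> ev n \<Longrightarrow> w \<cdot> n = st \<cdot> (w \<restriction> n)"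
    and "\<And>j. j \<epsilon> \<ss> n \<Longrightarrow> \<not> ev j \<Longrightarrow> z \<cdot> j = w \<cdot> j"
  shows "z \<cdot> n = w \<cdot> n"
proof -
  have "(\<forall>j. j \<epsilon> \<ss> n \<and> \<not> ev j \<longrightarrow> z \<cdot> j = w \<cdot> j) \<longrightarrow> z \<cdot> n = w \<cdot> n"
    using assms(1)
  proof (induction rule: omega_less_induct)
    case definable show ?case by (intro dfn dT_app dT_succ dP_ev)
  next
    case (less n)
    show ?case
    proof
      assume *: "\<forall>j. j \<epsilon> \<ss> n \<and> \<not> ev j \<longrightarrow> z \<cdot> j = w \<cdot> j"
      have "z \<cdot> k = w \<cdot> k" if "k \<epsilon> n" for k
        using less(2)[OF that] * that less_trans[OF less(1)] by auto
      then have "z \<restriction> n = w \<restriction> n"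
        using less(1) omega_trans by (intro restr_eq[OF assms(2,3)]) blast+
      then show "z \<cdot> n = w \<cdot> n"
        using assms(4,5)[OF less(1)] * by (cases "ev n") auto
    qed
  qed
  then show ?thesis using assms(6) by blast
qed

text \<open>
  The second player answers by the bits of \<open>x\<close> before time \<open>K\<close>, by 1 at time \<open>J\<close>, and by 0 otherwise
  unless 1 is prescribed.  For \<open>K = J = 0\<close> the first two clauses are void, as replies take place
  at odd times.
\<close>

lemma ex_zero_tail_play:
  "\<exists>z. maps mem z \<omega> \<omega> \<and> (\<forall>n. n \<epsilon> \<omega> \<longrightarrow> z \<cdot> n = (if ev n then st \<cdot> (z \<restriction> n)
     else if n \<epsilon> K then bit x n else if n = J then \<one> else if z \<cdot> pred n = \<one> then \<one> else \<zero>))"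
proof -
  define G where "G n s = (if ev n then st \<cdot> s
     else if n \<epsilon> K then bit x n else if n = J then \<one> else if s \<cdot> pred n = \<one> then \<one> else \<zero>)" for n s
  have "\<exists>z. maps mem z \<omega> \<omega> \<and> (\<forall>n. n \<epsilon> \<omega> \<longrightarrow> z \<cdot> n = G n (z \<restriction> n))"
  proof (rule ex_recursion)
    show "dP (\<lambda>e. e (Suc (Suc 0)) = G (e 0) (e (Suc 0)))"
      unfolding G_def by (intro dfn dP_ev dT_app dT_pred dT_bit)
    show "G n s \<epsilon> \<omega>" if "n \<epsilon> \<omega>" "maps mem s n \<omega>" for n s
      using that st_omega bit_omega by (simp add: G_def del: in_succ)
  qed
  then obtain z where z: "maps mem z \<omega> \<omega>" "\<And>n. n \<epsilon> \<omega> \<Longrightarrow> z \<cdot> n = G n (z \<restriction> n)" by blast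
  have "z \<restriction> n \<cdot> pred n = z \<cdot> pred n" if n: "n \<epsilon> \<omega>" "\<not> ev n" for n
  proof -
    obtain m where m: "m \<epsilon> \<omega>" "n = \<ss> m" using odd_cases[OF n] by blast
    have "z \<restriction> n \<cdot> m = z \<cdot> m"
      by (rule restr_maps(2)[OF z(1)]) (use m n(1) omega_trans in auto)
    then show ?thesis using m by simp
  qed
  then have "G n (z \<restriction> n) = (if ev n then st \<cdot> (z \<restriction> n)
     else if n \<epsilon> K then bit x n else if n = J then \<one> else if z \<cdot> pred n = \<one> then \<one> else \<zero>)"
    if "n \<epsilon> \<omega>" for n using that unfolding G_def by simp
  then show ?thesis using z by (intro exI[of _ z]) simp
qed

text \<open>Answering 0 to every open move is legal, so the win of \<open>st\<close> yields an
  element of \<open>S\<close> with such a tail.\<close>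

lemma ex_target: "\<exists>x. target x"
proof -
  obtain z where z: "maps mem z \<omega> \<omega>" "\<And>n. n \<epsilon> \<omega> \<Longrightarrow> z \<cdot> n = (if ev n then st \<cdot> (z \<restriction> n)
     else if n \<epsilon> \<zero> then bit \<zero> n else if n = \<zero> then \<one> else if z \<cdot> pred n = \<one> then \<one> else \<zero>)"
    using ex_zero_tail_play by blast
  have reply: "z \<cdot> \<ss> m = (if z \<cdot> m = \<one> then \<one> else \<zero>)" if "m \<epsilon> \<omega>" "ev m" for m
    using z(2)[of "\<ss> m"] that by simp
  have lz: "legal z" unfolding legal_def using reply by auto
  moreover have "z \<cdot> n = st \<cdot> (z \<restriction> n)" if "n \<epsilon> \<omega>" "ev n" for n using z(2) that by simp
  moreover have "z \<cdot> n = \<zero> \<or> z \<cdot> n = \<one>" if "n \<epsilon> \<omega>" "\<not> ev n" for n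
    using z(2)[OF that(1)] that by auto
  ultimately obtain y where "y \<epsilon> S" "bit_play y z" using legal_play(1)[OF z(1)] by blast
  moreover have "zero_tail \<zero> z" unfolding zero_tail_def using reply by auto
  ultimately show ?thesis unfolding target_def using lz zero_omega by blast
qed

text \<open>
  To pass to a slightly larger target, the second player changes one of his late open replies
  from 0 to 1.
\<close>

lemma ex_larger_target:
  assumes "target x" "m0 \<epsilon> \<omega>" "ev m0"
  shows "\<exists>y. target y \<and> x \<prec> y \<and> (q \<cdot> \<ss> m0 \<prec> y \<longrightarrow> q \<cdot> \<ss> m0 \<prec> x)"
proof -
  obtain z N where x: "x \<epsilon> S" and zp: "bit_play x z" and "legal z" and N: "N \<epsilon> \<omega>" "zero_tail N z"
    using assms(1) unfolding target_def by blast
  have z: "maps mem z \<omega> \<omega>" "\<And>n. n \<epsilon> \<omega> \<Longrightarrow> z \<cdot> n = (if ev n then st \<cdot> (z \<restriction> n) else bit x n)"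
    using zp unfolding bit_play_def by blast+
  have "inf_open z" using legal_bit_play(2)[OF zp \<open>legal z\<close>] S[OF x] by blast
  \<comment> \<open>\<open>M\<close> is the maximum of \<open>N\<close> and m0 + 1, so that the open
    move at \<open>j\<close> comes after \<open>m0\<close> and its reply belongs to the zero
    tail.\<close>
  moreover obtain M where M: "M \<epsilon> \<omega>" "\<And>j. j \<epsilon> \<omega> \<Longrightarrow> \<not> j \<epsilon> M \<Longrightarrow> \<not> j \<epsilon> N \<and> \<not> j \<epsilon> \<ss> m0"
  proof (cases "N \<epsilon> \<ss> m0")
    case True
    then show ?thesis using that[of "\<ss> m0"] assms(2) less_trans by (meson succ_omega)
  next
    case False
    then have "N = \<ss> m0 \<or> \<ss> m0 \<epsilon> N" using less_linear N(1) assms(2) succ_omega by blast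
    then show ?thesis using that[of N] N(1) less_trans by metis
  qed
  ultimately obtain j where j: "j \<epsilon> \<omega>" "ev j" "\<not> j \<epsilon> M" "z \<cdot> j \<noteq> \<zero>" "z \<cdot> j \<noteq> \<one>"
    unfolding inf_open_def by blast
  then have jN: "\<not> j \<epsilon> N" and "\<not> j \<epsilon> \<ss> m0" using M by blast+
  then have m0j: "m0 \<epsilon> j" using less_linear[OF j(1) assms(2)] by auto
  \<comment> \<open>Here \<open>K\<close> is \<open>j\<close> and \<open>J\<close> is j + 1: the
    reply to the open move at \<open>j\<close> is the one that changes.\<close>
  obtain w where w: "maps mem w \<omega> \<omega>" "\<And>n. n \<epsilon> \<omega> \<Longrightarrow> w \<cdot> n = (if ev n then st \<cdot> (w \<restriction> n)
     else if n \<epsilon> j then bit x n else if n = \<ss> j then \<one> else if w \<cdot> pred n = \<one> then \<one> else \<zero>)"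
    using ex_zero_tail_play by blast
  have we: "w \<cdot> n = st \<cdot> (w \<restriction> n)" if "n \<epsilon> \<omega>" "ev n" for n using that w(2) by simp
  have wo: "w \<cdot> n = \<zero> \<or> w \<cdot> n = \<one>" if "n \<epsilon> \<omega>" "\<not> ev n" for n
    using that w(2)[OF that(1)] bit_cases[of x n] by simp
  have agree: "w \<cdot> k = z \<cdot> k" if k: "k \<epsilon> \<ss> j" for k
  proof (rule plays_agree[OF _ w(1) z(1) we])
    show "k \<epsilon> \<omega>" using k omega_trans j(1) succ_omega by blast
    show "z \<cdot> n = st \<cdot> (z \<restriction> n)" if "n \<epsilon> \<omega>" "ev n" for n using that z(2) by simp
    show "w \<cdot> i = z \<cdot> i" if i: "i \<epsilon> \<ss> k" "\<not> ev i" for i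
    proof -
      have "i \<epsilon> \<ss> j" using i(1) k less_trans[OF succ_omega[OF j(1)]] by auto
      then have "i \<epsilon> j" using i(2) j(2) by auto
      then show ?thesis using w(2)[of i] z(2)[of i] i(2) omega_trans[OF j(1)] by simp
    qed
  qed
  have w1: "w \<cdot> \<ss> j = \<one>"
    using w(2)[of "\<ss> j"] j less_asym[of "\<ss> j" j] by simp
  have tail: "w \<cdot> \<ss> m = (if w \<cdot> m = \<one> then \<one> else \<zero>)" if "m \<epsilon> \<omega>" "ev m" "j \<epsilon> m" for m
  proof -
    have "\<not> \<ss> m \<epsilon> j" using less_trans[OF j(1), of "\<ss> m" m] less_asym[OF j(1), of m] that by auto
    moreover have "\<ss> m \<noteq> \<ss> j" using that j by auto
    ultimately show ?thesis using w(2)[of "\<ss> m"] that by simp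
  qed
  \<comment> \<open>As \<open>j\<close> is even, the reply to an even move before \<open>j\<close>
    also comes before \<open>j\<close>.\<close>
  have early: "\<ss> m \<epsilon> j" if "m \<epsilon> j" "ev m" for m
    using succ_less_succ[OF j(1) that(1)] j(2) that omega_trans[OF j(1) that(1)] by auto
  have lw: "legal w" unfolding legal_def
  proof (intro allI impI)
    fix m assume m: "m \<epsilon> \<omega> \<and> ev m"
    then consider "m \<epsilon> j" | "m = j" | "j \<epsilon> m" using less_linear j(1) by blast
    then show "(w \<cdot> m = \<zero> \<longrightarrow> w \<cdot> \<ss> m = \<zero>) \<and> (w \<cdot> m = \<one> \<longrightarrow> w \<cdot> \<ss> m \<noteq> \<zero>)"
    proof cases
      case 1
      then show ?thesis using agree[of m] agree[of "\<ss> m"] early m \<open>legal z\<close> unfolding legal_def by simp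
    next
      case 2
      then show ?thesis using agree[of j] j by simp
    next
      case 3
      then show ?thesis using tail m by simp
    qed
  qed
  obtain y where y: "y \<epsilon> S" "bit_play y w" using legal_play(1)[OF w(1) we wo lw] by blast
  have yb: "w \<cdot> n = bit y n" if "n \<epsilon> \<omega>" "\<not> ev n" for n
    using y(2) that unfolding bit_play_def by simp
  \<comment> \<open>The bound is j + 2 in order to exclude the altered reply at j + 1.\<close>
  have "zero_tail (\<ss> (\<ss> j)) w" unfolding zero_tail_def
  proof (intro allI impI, elim conjE)
    fix m assume m: "m \<epsilon> \<omega>" "ev m" "\<not> \<ss> m \<epsilon> \<ss> (\<ss> j)" "w \<cdot> m \<noteq> \<one>"
    then have "\<not> m \<epsilon> \<ss> j" using succ_less_succ[of "\<ss> j" m] j(1) by auto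
    then have "j \<epsilon> m" using less_linear[OF m(1) j(1)] by auto
    then show "w \<cdot> \<ss> m = \<zero>" using tail m by simp
  qed
  then have "target y" unfolding target_def using y lw j(1) succ_omega by blast
  moreover have "x \<prec> y"
  proof -
    have "q \<cdot> \<ss> j \<prec> y" using yb[of "\<ss> j"] w1 j bit_eq_one[of y "\<ss> j"] by simp
    \<comment> \<open>In the old play the reply at j + 1 belongs to the tail and is 0, so x \<le>
      q(j + 1) < y.\<close>
    moreover have "\<not> \<ss> j \<epsilon> N" using jN less_trans[OF N(1), of "\<ss> j" j] by auto
    then have "z \<cdot> \<ss> j = \<zero>" using N(2) j unfolding zero_tail_def by blast
    then have "\<not> q \<cdot> \<ss> j \<prec> x" using z(2)[of "\<ss> j"] j bit_neq_zero[of x "\<ss> j"] by simp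
    ultimately show ?thesis
      using not_less leq_less mapsD(2)[OF q succ_omega[OF j(1)]] S[OF x] by blast
  qed
  moreover have "q \<cdot> \<ss> m0 \<prec> x" if "q \<cdot> \<ss> m0 \<prec> y"
  proof -
    have "\<ss> m0 \<epsilon> j" using early m0j assms(3) by blast
    then have "w \<cdot> \<ss> m0 = z \<cdot> \<ss> m0" using agree by simp
    then have "bit y (\<ss> m0) = bit x (\<ss> m0)" using yb[of "\<ss> m0"] z(2)[of "\<ss> m0"] assms(2,3) by simp
    then show ?thesis using that bit_eq_one by metis
  qed
  ultimately show ?thesis by blast
qed

lemma target_S: "target x \<Longrightarrow> x \<epsilon> S"
  by (simp add: target_def)

text \<open>Take a point of \<open>q\<close> between \<open>x\<close> and \<open>v\<close> and keep
  its bit: a larger target then cannot rise above it.\<close>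

lemma ex_target_between:
  assumes "target x" "x \<prec> v" "v \<preceq> b0"
  shows "\<exists>y. target y \<and> x \<prec> y \<and> y \<prec> v"
proof -
  have x: "x \<epsilon> R" "a0 \<preceq> x" using S target_S assms(1) by blast+
  obtain m where m: "m \<epsilon> \<omega>" "ev m" "x \<prec> q \<cdot> \<ss> m" "q \<cdot> \<ss> m \<prec> v"
    using dense[OF x(2) assms(2,3)] by blast
  obtain y where y: "target y" "x \<prec> y" "q \<cdot> \<ss> m \<prec> y \<longrightarrow> q \<cdot> \<ss> m \<prec> x"
    using ex_larger_target[OF assms(1) m(1,2)] by blast
  then have "\<not> q \<cdot> \<ss> m \<prec> y" using m less_R_trans less_R_irrefl by blast
  then show ?thesis using y m not_less[of "q \<cdot> \<ss> m" y] less_R leq_less by blast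
qed

text \<open>Two increases are used: the first leaves \<open>a0\<close>, the second shows that the
  target reached is not \<open>b0\<close>.\<close>

lemma ex_target_start: "\<exists>y. target y \<and> a0 \<prec> y \<and> y \<prec> b0"
proof -
  obtain x where x: "target x" using ex_target by blast
  obtain y where y: "target y" "x \<prec> y" using ex_larger_target[OF x zero_omega ev_zero] by blast
  obtain y' where y': "target y'" "y \<prec> y'" using ex_larger_target[OF y(1) zero_omega ev_zero] by blast
  have "a0 \<preceq> x" "y' \<preceq> b0" using S[OF target_S[OF x]] S[OF target_S[OF y'(1)]] by blast+
  then have "a0 \<prec> y" "y \<prec> b0" using leq_less[OF _ y(2)] less_leq[OF y'(2)] by blast+
  then show ?thesis using y by blast
qed

text \<open>
  Bits are left continuous, so the play that answers truthfully about \<open>l\<close> agrees up to any given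
  time with such a play for a target.
\<close>

lemma left_limit_of_targets:
  assumes l: "l \<epsilon> R" "a0 \<prec> l" "l \<preceq> b0"
    and lim: "\<And>c. c \<prec> l \<Longrightarrow> \<exists>x. target x \<and> c \<prec> x \<and> x \<preceq> l"
  shows "l \<epsilon> S"
proof -
  \<comment> \<open>A new point q(k) matters only if it is below \<open>l\<close>; the interval to
    the left of \<open>l\<close> is then shortened to begin at or above it.\<close>
  have bits: "\<exists>c. c \<prec> l \<and> (\<forall>x i. c \<prec> x \<and> x \<preceq> l \<and> i \<epsilon> k \<longrightarrow> bit x i = bit l i)" if "k \<epsilon> \<omega>" for k
    using that
  proof (induction rule: omega_induct)
    case definable show ?case by (intro dfn dP_less dP_leq dT_bit)
  next
    case zero
    then show ?case using l by auto
  next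
    case (succ k)
    then obtain c where c: "c \<prec> l" "\<And>x i. c \<prec> x \<Longrightarrow> x \<preceq> l \<Longrightarrow> i \<epsilon> k \<Longrightarrow> bit x i = bit l i" by blast
    have qR: "q \<cdot> k \<epsilon> R" using q mapsD(2) succ(1) by blast
    show ?case
    proof (cases "q \<cdot> k \<prec> l")
      case False
      then have "bit x k = bit l k" if "x \<preceq> l" for x
        using that less_leq unfolding bit_def by auto
      then show ?thesis using c by (intro exI[of _ c]) auto
    next
      case True
      have lk: "bit x k = bit l k" if "q \<cdot> k \<prec> x" for x using that True by (simp add: bit_def)
      have "\<exists>c'. c' \<prec> l \<and> (c' = c \<or> c \<prec> c') \<and> (c' = q \<cdot> k \<or> q \<cdot> k \<prec> c')"
        using less_R_linear[OF qR, of c] less_R[OF c(1)] c(1) True by blast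
      then obtain c' where c': "c' \<prec> l" "c' = c \<or> c \<prec> c'" "c' = q \<cdot> k \<or> q \<cdot> k \<prec> c'" by blast
      have "bit x i = bit l i" if x: "c' \<prec> x" "x \<preceq> l" "i \<epsilon> \<ss> k" for x i
      proof -
        have "c \<prec> x" "q \<cdot> k \<prec> x" using c'(2,3) x(1) less_R_trans[OF _ x(1)] by auto
        then show ?thesis using x(2,3) c(2) lk by auto
      qed
      then show ?thesis using c'(1) by blast
    qed
  qed
  have "\<exists>w. maps mem w \<omega> \<omega> \<and> (\<forall>n. n \<epsilon> \<omega> \<longrightarrow>
      w \<cdot> n = (\<lambda>n s. if ev n then st \<cdot> s else bit l n) n (w \<restriction> n))"
    by (rule ex_recursion, intro dfn dP_ev dT_app dT_bit) (use st_omega bit_omega in simp)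
  then obtain w where w: "bit_play l w" unfolding bit_play_def by auto
  \<comment> \<open>Each instance of the rule involves only an initial segment of the play, so
    legality passes from nearby targets to \<open>l\<close>. For the times m and m + 1 the bits
    below m + 2 have to agree.\<close>
  have "legal w" unfolding legal_def
  proof (intro allI impI)
    fix m assume m: "m \<epsilon> \<omega> \<and> ev m"
    then have "\<ss> (\<ss> m) \<epsilon> \<omega>" using succ_omega by blast
    then obtain c where c: "c \<prec> l" "\<And>x i. c \<prec> x \<Longrightarrow> x \<preceq> l \<Longrightarrow> i \<epsilon> \<ss> (\<ss> m) \<Longrightarrow> bit x i = bit l i"
      using bits by metis
    obtain x where x: "target x" "c \<prec> x" "x \<preceq> l" using lim c(1) by blast
    obtain z where z: "bit_play x z" "legal z" using x(1) unfolding target_def by blast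
    have "z \<cdot> k = w \<cdot> k" if k: "k \<epsilon> \<ss> (\<ss> m)" for k
    proof (rule plays_agree)
      show "k \<epsilon> \<omega>" using k omega_trans m succ_omega by blast
      fix i assume i: "i \<epsilon> \<ss> k" "\<not> ev i"
      then have im: "i \<epsilon> \<ss> (\<ss> m)" using k less_trans[OF \<open>\<ss> (\<ss> m) \<epsilon> \<omega>\<close>] in_succ[of i k] by metis
      then have "i \<epsilon> \<omega>" using omega_trans[OF \<open>\<ss> (\<ss> m) \<epsilon> \<omega>\<close>] by blast
      then show "z \<cdot> i = w \<cdot> i" using c(2)[OF x(2,3) im] i(2) z(1) w unfolding bit_play_def by simp
    qed (use z(1) w in \<open>simp_all add: bit_play_def\<close>)
    then have "z \<cdot> m = w \<cdot> m" "z \<cdot> \<ss> m = w \<cdot> \<ss> m" by simp_all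
    then show "(w \<cdot> m = \<zero> \<longrightarrow> w \<cdot> \<ss> m = \<zero>) \<and> (w \<cdot> m = \<one> \<longrightarrow> w \<cdot> \<ss> m \<noteq> \<zero>)"
      using z(2) m unfolding legal_def by metis
  qed
  then show ?thesis using legal_bit_play(1)[OF w] l unfolding leq_in_def by blast
qed

text \<open>From stage \<open>N\<close> on the replies are 0 unless 1 is prescribed, and
  \<open>st\<close> supplies the even moves; thus \<open>N\<close> and the replies before it
  determine \<open>x\<close>.\<close>

lemma countable_targets:
  assumes D: "\<And>x. x \<epsilon> D \<Longrightarrow> target x"
  shows "countable_set mem D"
proof -
  \<comment> \<open>Here the replies are the digits, while the moves of \<open>st\<close>, which may
    be any numbers, are replaced by 0.\<close>
  define Rl where "Rl x d N \<longleftrightarrow> x \<epsilon> S \<and> N \<epsilon> \<omega> \<and> (\<exists>z. bit_play x z \<and> legal z \<and> zero_tail N z \<and>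
    (\<forall>n. n \<epsilon> \<omega> \<longrightarrow> d \<cdot> n = (if ev n then \<zero> else z \<cdot> n)))" for x d N
  show ?thesis
  proof (rule countable_by_digits[of Rl])
    show "dP (\<lambda>e. Rl (e 0) (e (Suc 0)) (e (Suc (Suc 0))))"
      unfolding Rl_def by (intro dfn dP_ev dT_app dP_bit_play dP_legal dP_zero_tail)
  next
    fix x d N assume "Rl x d N"
    moreover have "digit (bit x n)" for n using bit_cases by (auto simp: digit_def)
    moreover have "digit \<zero>" by (simp add: digit_def)
    ultimately show "N \<epsilon> \<omega> \<and> (\<forall>k. k \<epsilon> \<omega> \<longrightarrow> digit (d \<cdot> k))"
      unfolding Rl_def bit_play_def by auto
  next
    fix x assume "x \<epsilon> D"
    then obtain z N where x: "x \<epsilon> S" "bit_play x z" "legal z" "N \<epsilon> \<omega>" "zero_tail N z"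
      using D unfolding target_def by blast
    have "maps mem z \<omega> \<omega>" using x unfolding bit_play_def by blast
    then have "\<exists>d. maps mem d \<omega> \<omega> \<and> (\<forall>n. n \<epsilon> \<omega> \<longrightarrow> d \<cdot> n = (if ev n then \<zero> else z \<cdot> n))"
      by (intro ex_lam dfn dP_ev dT_app) (simp add: mapsD(2))
    then show "\<exists>d N. Rl x d N" unfolding Rl_def using x by blast
  next
    fix x y d e N
    assume "Rl x d N" "Rl y e N" and de: "\<And>k. k \<epsilon> N \<Longrightarrow> d \<cdot> k = e \<cdot> k"
    obtain z where z: "bit_play x z" "legal z" "zero_tail N z"
      "\<And>n. n \<epsilon> \<omega> \<Longrightarrow> d \<cdot> n = (if ev n then \<zero> else z \<cdot> n)"
      using \<open>Rl x d N\<close> unfolding Rl_def by blast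
    obtain w where w: "bit_play y w" "legal w" "zero_tail N w"
      "\<And>n. n \<epsilon> \<omega> \<Longrightarrow> e \<cdot> n = (if ev n then \<zero> else w \<cdot> n)"
      using \<open>Rl y e N\<close> unfolding Rl_def by blast
    have N: "x \<epsilon> S" "y \<epsilon> S" using \<open>Rl x d N\<close> \<open>Rl y e N\<close> unfolding Rl_def by blast+
    have maps: "maps mem z \<omega> \<omega>" "maps mem w \<omega> \<omega>" using z(1) w(1) unfolding bit_play_def by blast+
    have "z \<cdot> n = w \<cdot> n" if "n \<epsilon> \<omega>" for n
      using that
    proof (induction rule: omega_less_induct)
      case definable show ?case by (intro dfn dT_app)
    next
      case (less n)
      consider "ev n" | "\<not> ev n" "n \<epsilon> N" | "\<not> ev n" "\<not> n \<epsilon> N" by blast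
      then show ?case
      proof cases
        case 1
        have "z \<restriction> n = w \<restriction> n"
          using less omega_trans by (intro restr_eq[OF maps]) blast+
        then show ?thesis using z(1) w(1) less(1) 1 unfolding bit_play_def by simp
      next
        case 2 then show ?thesis using z(4) w(4) de less(1) by metis
      next
        case 3
        obtain m where m: "m \<epsilon> \<omega>" "ev m" "n = \<ss> m" using odd_cases[OF less(1) 3(1)] by blast
        have rep: "v \<cdot> n = (if v \<cdot> m = \<one> then \<one> else \<zero>)"
          if "bit_play u v" "legal v" "zero_tail N v" for u v
        proof -
          have "v \<cdot> n = \<zero> \<or> v \<cdot> n = \<one>"
            using that(1) less(1) 3(1) bit_cases[of u n] unfolding bit_play_def by simp
          then show ?thesis using that(2,3) m 3(2) unfolding legal_def zero_tail_def by metis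
        qed
        have "z \<cdot> m = w \<cdot> m" using less(2) m(3) by simp
        then show ?thesis using rep[OF z(1-3)] rep[OF w(1-3)] by simp
      qed
    qed
    then have "bit x (\<ss> m) = bit y (\<ss> m)" if "m \<epsilon> \<omega>" "ev m" for m
      using z(1) w(1) that succ_omega[OF that(1)] unfolding bit_play_def by (metis ev_succ)
    then show "x = y" using eq_by_bits S N by blast
  qed
qed

end

section \<open>The strategy in the Cantor game\<close>

context zf_reals
begin

definition position :: "'v \<Rightarrow> 'v \<Rightarrow> 'v \<Rightarrow> 'v \<Rightarrow> 'v \<Rightarrow> bool" where
  "position a0 b0 n a b \<longleftrightarrow> maps mem a n R \<and> maps mem b n R \<and>
     a \<cdot> \<zero> = a0 \<and> b \<cdot> \<zero> = b0 \<and> (\<forall>k. k \<epsilon> n \<longrightarrow> a \<cdot> k \<prec> b \<cdot> k) \<and>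
     (\<forall>k. \<ss> k \<epsilon> n \<longrightarrow> a \<cdot> k \<prec> a \<cdot> \<ss> k \<and> b \<cdot> \<ss> k \<prec> b \<cdot> k)"

lemma dP_position: "dT t \<Longrightarrow> dT u \<Longrightarrow> dT v \<Longrightarrow> dP (\<lambda>e. position a0 b0 (t e) (u e) (v e))"
  by (rule dP_subst3[of "position a0 b0"])
    (unfold position_def, intro dfn dP_maps dT_app dT_succ dP_less)

lemma in_positions:
  "p \<epsilon> positions mem R lt a0 b0 n \<longleftrightarrow> (\<exists>a b. p = \<langle>a, b\<rangle> \<and> position a0 b0 n a b)"
proof -
  obtain V where V: "\<And>z. z \<epsilon> V \<longleftrightarrow> (\<forall>y. y \<epsilon> z \<longrightarrow> y \<epsilon> cart mem n R)" using ex_power by metis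
  have "\<exists>s. \<forall>p. p \<epsilon> s \<longleftrightarrow> (\<exists>a b. p = \<langle>a, b\<rangle> \<and> position a0 b0 n a b)"
  proof (rule ex_bounded[of _ "cart mem V V"])
    show "dP (\<lambda>e. \<exists>a b. e 0 = \<langle>a, b\<rangle> \<and> position a0 b0 n a b)"
      by (intro dfn dT_pair dP_position)
    show "p \<epsilon> cart mem V V" if "\<exists>a b. p = \<langle>a, b\<rangle> \<and> position a0 b0 n a b" for p
      using that maps_in_cart unfolding in_cart V position_def by blast
  qed
  from in_setof[OF this] show ?thesis unfolding positions_def position_def .
qed

lemma dT_positions: "dT t \<Longrightarrow> dT (\<lambda>e. positions mem R lt a0 b0 (t e))"
  by (rule dT_fun1) (subst ext_iff, unfold in_positions, intro dfn dT_pair dP_position)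

text \<open>Density of \<open>q\<close> is known only within [a0, b0]; these bounds allow
  \<open>choice_step\<close> to be applied at every position.\<close>

lemma position_bounds:
  assumes "position a0 b0 (\<ss> m) a b" "m \<epsilon> \<omega>"
  shows "a0 \<preceq> a \<cdot> m" "a \<cdot> m \<prec> b \<cdot> m" "b \<cdot> m \<preceq> b0"
proof -
  have "k \<epsilon> \<ss> m \<longrightarrow> a0 \<preceq> a \<cdot> k \<and> b \<cdot> k \<preceq> b0" if "k \<epsilon> \<omega>" for k
    using that
  proof (induction rule: omega_induct)
    case definable show ?case by (intro dfn dP_leq dT_app)
  next
    case zero show ?case using assms(1) by (simp add: position_def leq_in_def)
  next
    case (succ k)
    show ?case
    proof
      assume k: "\<ss> k \<epsilon> \<ss> m"
      then have "k \<epsilon> \<ss> m" using less_trans[of "\<ss> m" "\<ss> k" k] assms(2) by simp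
      then have "a0 \<preceq> a \<cdot> k" "b \<cdot> k \<preceq> b0" using succ by blast+
      moreover have "a \<cdot> k \<prec> a \<cdot> \<ss> k" "b \<cdot> \<ss> k \<prec> b \<cdot> k"
        using assms(1) k unfolding position_def by blast+
      ultimately show "a0 \<preceq> a \<cdot> \<ss> k \<and> b \<cdot> \<ss> k \<preceq> b0"
        using leq_less[of a0] less_leq[of _ _ b0] unfolding leq_in_def by metis
    qed
  qed
  then show "a0 \<preceq> a \<cdot> m" "b \<cdot> m \<preceq> b0" using assms(2) by simp_all
  show "a \<cdot> m \<prec> b \<cdot> m" using assms(1) by (simp add: position_def)
qed

lemma in_limit_set:
  "l \<epsilon> limit_set mem R add lt zr a0 b0 F \<longleftrightarrow>
     (\<exists>a b. cantor_play mem R lt a0 b0 a b \<and> consistent_play mem F a b \<and> seq_limit mem R add lt zr a l)"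
  unfolding limit_set_def
proof (rule in_setof, rule ex_bounded[of _ R])
  show "dP (\<lambda>e. \<exists>a b. cantor_play mem R lt a0 b0 a b \<and> consistent_play mem F a b \<and>
      seq_limit mem R add lt zr a (e 0))"
    unfolding cantor_play_def consistent_play_def seq_limit_def
    by (intro dfn dP_maps dT_app dT_succ dT_pair dT_restr dP_less dT_op2)
qed (auto simp: seq_limit_def)

lemma play_position:
  assumes "cantor_play mem R lt a0 b0 a b" "a0 \<prec> b0" "m \<epsilon> \<omega>"
  shows "position a0 b0 (\<ss> m) (a \<restriction> \<ss> m) (b \<restriction> \<ss> m)"
    "a \<restriction> \<ss> m \<cdot> m = a \<cdot> m" "b \<restriction> \<ss> m \<cdot> m = b \<cdot> m"
proof -
  have maps: "maps mem a \<omega> R" "maps mem b \<omega> R" and start: "a \<cdot> \<zero> = a0" "b \<cdot> \<zero> = b0"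
    and step: "\<And>n. n \<epsilon> \<omega> \<Longrightarrow> a \<cdot> n \<prec> a \<cdot> \<ss> n \<and> a \<cdot> \<ss> n \<prec> b \<cdot> \<ss> n \<and> b \<cdot> \<ss> n \<prec> b \<cdot> n"
    using assms(1) unfolding cantor_play_def by blast+
  have sub: "x \<epsilon> \<omega>" if "x \<epsilon> \<ss> m" for x using omega_trans[OF succ_omega[OF assms(3)] that] .
  have ra: "a \<restriction> \<ss> m \<cdot> k = a \<cdot> k" "b \<restriction> \<ss> m \<cdot> k = b \<cdot> k" if "k \<epsilon> \<ss> m" for k
    using restr_maps(2)[OF maps(1)] restr_maps(2)[OF maps(2)] sub that by blast+
  then show "a \<restriction> \<ss> m \<cdot> m = a \<cdot> m" "b \<restriction> \<ss> m \<cdot> m = b \<cdot> m" by simp_all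
  have z: "\<zero> \<epsilon> \<ss> m" using less_linear[OF zero_omega assms(3)] by auto
  \<comment> \<open>A play compares its two sequences from index 1 on; index 0 is the hypothesis a0
    < b0.\<close>
  have lt: "a \<cdot> k \<prec> b \<cdot> k" if "k \<epsilon> \<omega>" for k
    using that by (cases rule: omega_cases) (use start assms(2) step in auto)
  show "position a0 b0 (\<ss> m) (a \<restriction> \<ss> m) (b \<restriction> \<ss> m)"
    unfolding position_def
  proof (intro conjI allI impI)
    show "maps mem (a \<restriction> \<ss> m) (\<ss> m) R" "maps mem (b \<restriction> \<ss> m) (\<ss> m) R"
      using restr_maps(1)[OF maps(1)] restr_maps(1)[OF maps(2)] sub by blast+
    show "a \<restriction> \<ss> m \<cdot> \<zero> = a0" "b \<restriction> \<ss> m \<cdot> \<zero> = b0" using ra z start by simp_all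
    show "a \<restriction> \<ss> m \<cdot> k \<prec> b \<restriction> \<ss> m \<cdot> k" if "k \<epsilon> \<ss> m" for k using ra[OF that] lt[OF sub[OF that]] by simp
    fix k assume k: "\<ss> k \<epsilon> \<ss> m"
    then have k': "k \<epsilon> \<ss> m" using less_trans[of "\<ss> m" "\<ss> k" k] assms(3) by simp
    show "a \<restriction> \<ss> m \<cdot> k \<prec> a \<restriction> \<ss> m \<cdot> \<ss> k" "b \<restriction> \<ss> m \<cdot> \<ss> k \<prec> b \<restriction> \<ss> m \<cdot> k"
      using ra[OF k] ra[OF k'] step[OF sub[OF k']] by simp_all
  qed
qed

end

context cut_game_won
begin

text \<open>
  Choosing between two reals without the axiom of choice: targets come from a countable set, and
  the values of \<open>q\<close> serve as default.
\<close>

lemma choice_step: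
  obtains step where "dP (\<lambda>e. step (e 0) (e (Suc 0)) (e (Suc (Suc 0))))"
    "\<And>u v. a0 \<preceq> u \<Longrightarrow> u \<prec> v \<Longrightarrow> v \<preceq> b0 \<Longrightarrow> \<exists>!y. step u v y"
    "\<And>u v y. step u v y \<Longrightarrow> u \<prec> y \<and> y \<prec> v"
    "\<And>u v x y. step u v y \<Longrightarrow> target x \<Longrightarrow> u \<prec> x \<Longrightarrow> x \<prec> v \<Longrightarrow> target y"
proof -
  have "dP (\<lambda>e. target (e 0))" by (intro dP_target dfn)
  from ex_separation[OF this, of S] obtain D where D: "\<And>x. x \<epsilon> D \<longleftrightarrow> target x"
    using target_S by metis
  have "countable_set mem D" using countable_targets D by blast
  then obtain f where f: "maps mem f D \<omega>" "\<And>x y. x \<epsilon> D \<Longrightarrow> y \<epsilon> D \<Longrightarrow> f \<cdot> x = f \<cdot> y \<Longrightarrow> x = y"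
    unfolding countable_set_def by blast
  define between where "between u v y \<longleftrightarrow> target y \<and> u \<prec> y \<and> y \<prec> v" for u v y
  define code where "code u v n \<longleftrightarrow> (\<exists>y. between u v y \<and> f \<cdot> y = n)" for u v n
  define qin where "qin u v n \<longleftrightarrow> u \<prec> q \<cdot> n \<and> q \<cdot> n \<prec> v" for u v n
  \<comment> \<open>Among the targets in the interval the one of least code is taken. The second
    alternative keeps the strategy total at positions whose interval contains no target.\<close>
  define step where "step u v y \<longleftrightarrow>
    (between u v y \<and> f \<cdot> y \<epsilon> \<omega> \<and> code u v (f \<cdot> y) \<and> (\<forall>j. j \<epsilon> f \<cdot> y \<longrightarrow> \<not> code u v j)) \<or>
    ((\<forall>x. \<not> between u v x) \<and> (\<exists>n. (n \<epsilon> \<omega> \<and> qin u v n \<and> (\<forall>j. j \<epsilon> n \<longrightarrow> \<not> qin u v j)) \<and> y = q \<cdot> n))"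
    for u v y
  have "dP (\<lambda>e. step (e 0) (e (Suc 0)) (e (Suc (Suc 0))))"
    unfolding step_def code_def between_def qin_def by (intro dfn dP_target dP_less dT_app)
  moreover have "\<exists>!y. step u v y" if uv: "a0 \<preceq> u" "u \<prec> v" "v \<preceq> b0" for u v
  proof (cases "\<exists>x. between u v x")
    case True
    then obtain x where x: "between u v x" by blast
    have "f \<cdot> x \<epsilon> \<omega>" using mapsD(2)[OF f(1)] D x unfolding between_def by blast
    moreover have "code u v (f \<cdot> x)" using x code_def by blast
    moreover have "dP (\<lambda>e. code u v (e 0))"
      unfolding code_def between_def by (intro dfn dP_target dP_less dT_app)
    ultimately obtain n where n: "n \<epsilon> \<omega>" "code u v n" "\<forall>j. j \<epsilon> n \<longrightarrow> \<not> code u v j"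
      and n': "\<And>k. k \<epsilon> \<omega> \<and> code u v k \<and> (\<forall>j. j \<epsilon> k \<longrightarrow> \<not> code u v j) \<Longrightarrow> k = n"
      using ex1_least[of "code u v"] by blast
    obtain y where y: "between u v y" "f \<cdot> y = n" using n(2) unfolding code_def by blast
    show ?thesis
    proof (rule ex1I[of _ y])
      show "step u v y" unfolding step_def using y n by blast
      fix y' assume "step u v y'"
      then have y': "between u v y'" "f \<cdot> y' = n" using True n' unfolding step_def by blast+
      then show "y' = y" using f(2) y D unfolding between_def by metis
    qed
  next
    case False
    obtain m where "m \<epsilon> \<omega>" "qin u v (\<ss> m)" unfolding qin_def using dense[OF uv] by blast
    moreover have "dP (\<lambda>e. qin u v (e 0))" unfolding qin_def by (intro dfn dP_less dT_app)
    ultimately have "\<exists>!n. n \<epsilon> \<omega> \<and> qin u v n \<and> (\<forall>j. j \<epsilon> n \<longrightarrow> \<not> qin u v j)"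
      using ex1_least[of "qin u v" "\<ss> m"] succ_omega by blast
    then show ?thesis unfolding step_def using False by blast
  qed
  moreover have "u \<prec> y \<and> y \<prec> v" if "step u v y" for u v y
    using that unfolding step_def between_def qin_def by blast
  moreover have "target y" if "step u v y" "target x" "u \<prec> x" "x \<prec> v" for u v x y
    using that unfolding step_def between_def by blast
  ultimately show thesis by (rule that)
qed

text \<open>The moves increase strictly, so their limit is a supremum approached by targets from the
  left.\<close>

lemma limit_in_S:
  assumes play: "cantor_play mem R lt a0 b0 a b" and lim: "seq_limit mem R add lt zr a l"
    and targets: "\<And>m. m \<epsilon> \<omega> \<Longrightarrow> target (a \<cdot> \<ss> m)"
  shows "l \<epsilon> S"
proof -
  have maps: "maps mem a \<omega> R" and start: "a \<cdot> \<zero> = a0"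
    and incr: "\<And>n. n \<epsilon> \<omega> \<Longrightarrow> a \<cdot> n \<prec> a \<cdot> \<ss> n"
    using play unfolding cantor_play_def by blast+
  have lR: "l \<epsilon> R" using lim unfolding seq_limit_def by blast
  have L: "\<exists>N. N \<epsilon> \<omega> \<and> (\<forall>n. n \<epsilon> \<omega> \<and> (N = n \<or> N \<epsilon> n) \<longrightarrow> a \<cdot> n \<prec> l \<oplus> d \<and> l \<prec> a \<cdot> n \<oplus> d)"
    if "zr \<prec> d" for d using lim less_R(2)[OF that] that unfolding seq_limit_def by blast
  have aR: "a \<cdot> n \<epsilon> R" if "n \<epsilon> \<omega>" for n using maps mapsD(2) that by blast
  have mono: "\<forall>k. k \<epsilon> n \<longrightarrow> a \<cdot> k \<prec> a \<cdot> n" if "n \<epsilon> \<omega>" for n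
    using that
  proof (induction rule: omega_induct)
    case definable show ?case by (intro dfn dP_less dT_app)
  next
    case (succ n)
    then show ?case using incr less_R_trans by auto
  qed simp
  have below: "a \<cdot> n \<preceq> l" if n: "n \<epsilon> \<omega>" for n
  proof (rule ccontr)
    assume "\<not> a \<cdot> n \<preceq> l"
    then have "l \<prec> a \<cdot> n" using not_leq aR n lR by blast
    then obtain d where d: "l \<oplus> d = a \<cdot> n" "zr \<prec> d" using ex_diff[OF lR aR[OF n]] by blast
    obtain N where N: "N \<epsilon> \<omega>" "\<And>k. k \<epsilon> \<omega> \<Longrightarrow> N = k \<or> N \<epsilon> k \<Longrightarrow> a \<cdot> k \<prec> a \<cdot> n"
      using L[OF d(2)] d(1) by metis
    show False
      using less_linear[OF N(1) n] N(2)[OF n] N(2)[OF N(1)] mono[OF N(1)] less_R_irrefl less_R_trans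
      by blast
  qed
  have close: "\<exists>n. n \<epsilon> \<omega> \<and> c \<prec> a \<cdot> n" if "c \<prec> l" for c
  proof -
    obtain d where d: "c \<oplus> d = l" "zr \<prec> d" using ex_diff[OF less_R[OF \<open>c \<prec> l\<close>]] \<open>c \<prec> l\<close> by blast
    obtain n where n: "n \<epsilon> \<omega>" "l \<prec> a \<cdot> n \<oplus> d" using L[OF d(2)] by blast
    have "\<not> a \<cdot> n \<preceq> c"
    proof
      assume "a \<cdot> n \<preceq> c"
      then have "a \<cdot> n \<oplus> d \<preceq> c \<oplus> d"
        using add_less_mono less_R(2)[OF d(2)] unfolding leq_in_def by blast
      then show False using n(2) d(1) less_leq less_R_irrefl by metis
    qed
    then show ?thesis using not_leq aR n(1) less_R(1)[OF \<open>c \<prec> l\<close>] by blast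
  qed
  show ?thesis
  proof (rule left_limit_of_targets[OF lR])
    show "a0 \<prec> l" using less_leq[OF _ below] incr[OF zero_omega] start by simp
    show "\<exists>x. target x \<and> c \<prec> x \<and> x \<preceq> l" if c: "c \<prec> l" for c
    proof -
      obtain n where "n \<epsilon> \<omega>" "c \<prec> a \<cdot> n" using close[OF c] by blast
      then show ?thesis using targets below incr less_R_trans succ_omega by blast
    qed
    have bR: "b0 \<epsilon> R" using ab less_R by blast
    show "l \<preceq> b0"
    proof (rule ccontr)
      assume "\<not> l \<preceq> b0"
      then obtain n where n: "n \<epsilon> \<omega>" "b0 \<prec> a \<cdot> n" using close not_leq lR bR by blast
      then have "b0 \<prec> a \<cdot> \<ss> n" using incr less_R_trans by blast
      moreover have "a \<cdot> \<ss> n \<preceq> b0" using S target_S targets n(1) by blast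
      ultimately show False using not_leq bR less_R(2) by blast
    qed
  qed
qed

lemma ex_winning_strategy: "\<exists>F. winning_strategy_A mem R add lt zr a0 b0 S F"
proof -
  obtain step where dstep: "dP (\<lambda>e. step (e 0) (e (Suc 0)) (e (Suc (Suc 0))))"
    and step1: "\<And>u v. a0 \<preceq> u \<Longrightarrow> u \<prec> v \<Longrightarrow> v \<preceq> b0 \<Longrightarrow> \<exists>!y. step u v y"
    and stepb: "\<And>u v y. step u v y \<Longrightarrow> u \<prec> y \<and> y \<prec> v"
    and stept: "\<And>u v x y. step u v y \<Longrightarrow> target x \<Longrightarrow> u \<prec> x \<Longrightarrow> x \<prec> v \<Longrightarrow> target y"
    by (rule choice_step) (rule that; assumption)
  define pos where "pos m = positions mem R lt a0 b0 (\<ss> m)" for m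
  define move where "move m p y \<longleftrightarrow> (\<exists>a b. p = \<langle>a, b\<rangle> \<and> step (a \<cdot> m) (b \<cdot> m) y)" for m p y
  define Q where "Q m f \<longleftrightarrow> function_on mem f (pos m) \<and> (\<forall>p. p \<epsilon> pos m \<longrightarrow> move m p (f \<cdot> p))" for m f
  have dmove: "dP (\<lambda>e. move (t e) (u e) (v e))" if "dT t" "dT u" "dT v" for t u v
    by (rule dP_subst3[of move, OF _ that])
      (unfold move_def, intro dfn dT_pair dT_app dP_subst3[of step, OF dstep])
  have move1: "\<exists>!y. move m p y" if m: "m \<epsilon> \<omega>" "p \<epsilon> pos m" for m p
  proof -
    obtain a b where p: "p = \<langle>a, b\<rangle>" "position a0 b0 (\<ss> m) a b"
      using m(2) unfolding pos_def in_positions by blast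
    then show ?thesis using step1[OF position_bounds[OF p(2) m(1)]] unfolding move_def by simp
  qed
  \<comment> \<open>The functions F(m) are unique by extensionality, so the sequence
    \<open>F\<close> too is obtained by replacement.\<close>
  have "\<exists>F. function_on mem F \<omega> \<and> (\<forall>m. m \<epsilon> \<omega> \<longrightarrow> Q m (F \<cdot> m))"
  proof (rule ex_function)
    show "dP (\<lambda>e. Q (e 0) (e (Suc 0)))"
      unfolding Q_def pos_def by (intro dfn dP_function_on dT_positions dT_succ dmove dT_app)
    fix m assume m: "m \<epsilon> \<omega>"
    have "\<exists>f. function_on mem f (pos m) \<and> (\<forall>p. p \<epsilon> pos m \<longrightarrow> move m p (f \<cdot> p))"
      by (rule ex_function) (intro dmove dfn, rule move1[OF m])
    moreover have "f = g" if fg: "Q m f" "Q m g" for f g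
      by (rule function_ext[of _ "pos m"]) (use fg move1[OF m] in \<open>unfold Q_def, blast+\<close>)
    ultimately show "\<exists>!f. Q m f" unfolding Q_def by blast
  qed
  then obtain F where F: "function_on mem F \<omega>" "\<And>m. m \<epsilon> \<omega> \<Longrightarrow> Q m (F \<cdot> m)" by blast
  have Fstep: "step (a \<cdot> m) (b \<cdot> m) (F \<cdot> m \<cdot> \<langle>a, b\<rangle>)" if m: "m \<epsilon> \<omega>" "\<langle>a, b\<rangle> \<epsilon> pos m" for m a b
    using F(2)[OF m(1)] m(2) unfolding Q_def move_def by fastforce
  have strat: "strategy_A mem R lt a0 b0 F"
    unfolding strategy_A_def pos_def[symmetric]
  proof (intro conjI allI impI)
    show "function_on mem F \<omega>" by (rule F(1))
    fix m assume m: "m \<epsilon> \<omega>"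
    show "a \<cdot> m \<prec> F \<cdot> m \<cdot> \<langle>a, b\<rangle>" "F \<cdot> m \<cdot> \<langle>a, b\<rangle> \<prec> b \<cdot> m" if "\<langle>a, b\<rangle> \<epsilon> pos m" for a b
      using stepb[OF Fstep[OF m that]] by blast+
    have "F \<cdot> m \<cdot> p \<epsilon> R" if p: "p \<epsilon> pos m" for p
    proof -
      obtain a b where "p = \<langle>a, b\<rangle>" using p unfolding pos_def in_positions by blast
      then show ?thesis using stepb[OF Fstep[OF m, of a b]] p less_R by blast
    qed
    then show "maps mem (F \<cdot> m) (pos m) R"
      using F(2)[OF m] unfolding maps_def Q_def by blast
  qed
  have "l \<epsilon> S" if l: "l \<epsilon> limit_set mem R add lt zr a0 b0 F" for l
  proof -
    obtain a b where play: "cantor_play mem R lt a0 b0 a b" and cons: "consistent_play mem F a b"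
      and lim: "seq_limit mem R add lt zr a l" using l unfolding in_limit_set by blast
    have st: "step (a \<cdot> m) (b \<cdot> m) (a \<cdot> \<ss> m)" if m: "m \<epsilon> \<omega>" for m
    proof -
      note pp = play_position[OF play ab m]
      have "\<langle>a \<restriction> \<ss> m, b \<restriction> \<ss> m\<rangle> \<epsilon> pos m" unfolding pos_def in_positions using pp(1) by blast
      from Fstep[OF m this] show ?thesis
        using cons m pp(2,3) unfolding consistent_play_def by simp
    qed
    have bounds: "a \<cdot> m \<prec> b \<cdot> m" "b \<cdot> m \<preceq> b0" if m: "m \<epsilon> \<omega>" for m
      using position_bounds(2,3)[OF play_position(1)[OF play ab m] m]
        play_position(2,3)[OF play ab m] by simp_all
    \<comment> \<open>Invariant of the play: once \<open>a\<close> has reached a target,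
      \<open>ex_target_between\<close> provides another one in the interval that player B leaves, so
      \<open>step\<close> moves to a target. The start needs \<open>ex_target_start\<close>, as
      \<open>a0\<close> may fail to be a target.\<close>
    have "target (a \<cdot> \<ss> m)" if "m \<epsilon> \<omega>" for m
      using that
    proof (induction rule: omega_induct)
      case definable show ?case by (intro dP_target dT_app dT_succ dfn)
    next
      case zero
      have "a \<cdot> \<zero> = a0" "b \<cdot> \<zero> = b0" using play unfolding cantor_play_def by blast+
      then show ?case using st[OF zero_omega] stept ex_target_start by metis
    next
      case (succ m)
      then show ?case
        using ex_target_between[OF succ(2) bounds[OF succ_omega[OF succ(1)]]]
          st[OF succ_omega[OF succ(1)]] stept by blast
    qed
    then show ?thesis using limit_in_S[OF play lim] by blast
  qed
  then show ?thesis
    unfolding winning_strategy_A_def subset_of_def using strat by blast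
qed

end

lemma (in cut_game) countable_or_winning_strategy:
  assumes "AD mem"
  shows "countable_set mem S \<or> (\<exists>F. winning_strategy_A mem R add lt zr a0 b0 S F)"
proof -
  have "\<exists>X. \<forall>z. z \<epsilon> X \<longleftrightarrow> payoff z"
    by (rule ex_maps[OF dP_payoff, of \<omega> \<omega>]) (simp add: payoff_def)
  then obtain X where X: "\<And>z. z \<epsilon> X \<longleftrightarrow> payoff z" by blast
  have "(\<exists>s. maps mem s (finseqs mem \<omega>) \<omega> \<and> wins_first mem s X) \<or>
     (\<exists>s. maps mem s (finseqs mem \<omega>) \<omega> \<and> wins_second mem s X)"
    using assms X unfolding AD_def payoff_def by blast
  then show ?thesis
  proof (elim disjE exE conjE)
    fix s assume s: "maps mem s (finseqs mem \<omega>) \<omega>" "wins_first mem s X"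
    interpret cut_game_won mem R add mul lt zr one a0 b0 S q s
      by unfold_locales (use s X in \<open>auto simp: wins_first_def\<close>)
    show ?thesis using ex_winning_strategy by blast
  next
    fix s assume s: "maps mem s (finseqs mem \<omega>) \<omega>" "wins_second mem s X"
    then show ?thesis
      using countable_if_wins_second[OF s(1)] X unfolding wins_second_def by blast
  qed
qed

theorem theorem8:
  fixes mem :: "'v \<Rightarrow> 'v \<Rightarrow> bool"
    and R add mul lt zr one :: 'v
  assumes "ZF_model mem"
    and "AD mem"
    and "complete_ordered_field mem R add mul lt zr one"
  shows "\<forall>a0 b0 S. mem a0 R \<and> mem b0 R \<and> less_in mem lt a0 b0 \<and>
           subset_of mem S (closed_interval mem R lt a0 b0) \<and> \<not> countable_set mem S \<longrightarrow>
           (\<exists>F. winning_strategy_A mem R add lt zr a0 b0 S F)"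
proof (intro allI impI, elim conjE)
  fix a0 b0 S
  assume ab: "less_in mem lt a0 b0" and S: "subset_of mem S (closed_interval mem R lt a0 b0)"
    and nc: "\<not> countable_set mem S"
  interpret zf_reals mem R add mul lt zr one
    using assms(1,3) by unfold_locales
  obtain q where q: "maps mem q (omega mem) R" "\<And>x y. leq_in mem lt a0 x \<Longrightarrow> less_in mem lt x y \<Longrightarrow>
      leq_in mem lt y b0 \<Longrightarrow> \<exists>m. mem m (omega mem) \<and> even_nat mem m \<and>
        less_in mem lt x (app mem q (succ mem m)) \<and> less_in mem lt (app mem q (succ mem m)) y"
    using ex_dense[OF ab] by blast
  have ci: "mem x (closed_interval mem R lt a0 b0) \<longleftrightarrow>
      mem x R \<and> leq_in mem lt a0 x \<and> leq_in mem lt x b0" for x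
    unfolding closed_interval_def by (rule in_setof, rule ex_bounded[of _ R], intro dfn dP_leq) blast
  interpret cut_game mem R add mul lt zr one a0 b0 S q
    by unfold_locales (use ab S q ci in \<open>auto simp: subset_of_def\<close>)
  show "\<exists>F. winning_strategy_A mem R add lt zr a0 b0 S F"
    using countable_or_winning_strategy[OF assms(2)] nc by blast
qed

end
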